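(* A pointed category $\mathbb{C}$ with finite limits is additive if and only if it satisfies Condition P.
   Context: A pointed category with binary products is additive when each hom-set is equipped with an abelian group structure such that addition is bilinear with respect to composition. A feeble pullback in a category with finite limits is a commutative square such that the unique induced morphism from its initial corner into the pullback is a regular epimorphism. A category $\mathbb{C}$ with finite limits is said to satisfy Condition P if: (a) finite coproducts exist in $\mathbb{C}$; (b) binary coproducts of pullback squares are pullback squares in $\mathbb{C}$ (that is, given two pullback squares, the square obtained by taking the binary coproduct of corresponding objects and morphisms is a pullback); (c) for each monomorphism $m:S\to A$ in $\mathbb{C}$, the commutative square with top $m+1_S:S+S\to A+S$, left side $[1_S,1_S]:S+S\to S$, right side $[1_A,m]:A+S\to A$ and bottom $m:S\to A$ is a pullback; (d) for each regular epimorphism $p:E\to B$ in $\mathbb{C}$, the commutative square with top $p+p:E+E\to B+B$, left side $[1_E,1_E]:E+E\to E$, right side $[1_B,1_B]:B+B\to B$ and bottom $p:E\to B$ is a feeble pullback. *)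

theory Defs
  imports "HOL-Algebra.Group"
begin

section \<open>Categories\<close>

record ('o, 'm) cat =
  Obj :: "'o set"
  Arr :: "'m set"
  Dom :: "'m \<Rightarrow> 'o"
  Cod :: "'m \<Rightarrow> 'o"
  Id :: "'o \<Rightarrow> 'm"
  Comp :: "'m \<Rightarrow> 'm \<Rightarrow> 'm"  (infixr "\<bullet>\<index>" 70)

definition Hom :: "('o, 'm) cat \<Rightarrow> 'o \<Rightarrow> 'o \<Rightarrow> 'm set" where
  "Hom C A B = {f \<in> Arr C. Dom C f = A \<and> Cod C f = B}"

text \<open>Composition is written in the usual order, first \<open>f\<close> and then \<open>g\<close> in \<open>g \<bullet> f\<close>. The
  operations are unconstrained outside the carriers and on non-composable pairs.\<close>

locale category =
  fixes C :: "('o, 'm) cat" (structure)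
  assumes Dom_Obj: "f \<in> Arr C \<Longrightarrow> Dom C f \<in> Obj C"
    and Cod_Obj: "f \<in> Arr C \<Longrightarrow> Cod C f \<in> Obj C"
    and Id_Hom: "A \<in> Obj C \<Longrightarrow> Id C A \<in> Hom C A A"
    and Comp_Hom: "f \<in> Hom C A B \<Longrightarrow> g \<in> Hom C B D \<Longrightarrow> g \<bullet> f \<in> Hom C A D"
    and Comp_assoc: "f \<in> Hom C A B \<Longrightarrow> g \<in> Hom C B D \<Longrightarrow> h \<in> Hom C D E \<Longrightarrow>
      (h \<bullet> g) \<bullet> f = h \<bullet> (g \<bullet> f)"
    and Id_left: "f \<in> Hom C A B \<Longrightarrow> Id C B \<bullet> f = f"
    and Id_right: "f \<in> Hom C A B \<Longrightarrow> f \<bullet> Id C A = f"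


section \<open>Finite limits\<close>

definition is_functor ::
  "('i, 'j) cat \<Rightarrow> ('o, 'm) cat \<Rightarrow> ('i \<Rightarrow> 'o) \<Rightarrow> ('j \<Rightarrow> 'm) \<Rightarrow> bool" where
  "is_functor J C Fo Fa \<longleftrightarrow>
     (\<forall>x\<in>Obj J. Fo x \<in> Obj C) \<and>
     (\<forall>a\<in>Arr J. Fa a \<in> Hom C (Fo (Dom J a)) (Fo (Cod J a))) \<and>
     (\<forall>x\<in>Obj J. Fa (Id J x) = Id C (Fo x)) \<and>
     (\<forall>a\<in>Arr J. \<forall>b\<in>Arr J. Cod J a = Dom J b \<longrightarrow> Fa (b \<bullet>\<^bsub>J\<^esub> a) = Fa b \<bullet>\<^bsub>C\<^esub> Fa a)"

definition is_cone ::
  "('i, 'j) cat \<Rightarrow> ('o, 'm) cat \<Rightarrow> ('i \<Rightarrow> 'o) \<Rightarrow> ('j \<Rightarrow> 'm) \<Rightarrow> 'o \<Rightarrow> ('i \<Rightarrow> 'm) \<Rightarrow> bool" where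
  "is_cone J C Fo Fa L p \<longleftrightarrow>
     L \<in> Obj C \<and>
     (\<forall>x\<in>Obj J. p x \<in> Hom C L (Fo x)) \<and>
     (\<forall>a\<in>Arr J. Fa a \<bullet>\<^bsub>C\<^esub> p (Dom J a) = p (Cod J a))"

definition is_limit ::
  "('i, 'j) cat \<Rightarrow> ('o, 'm) cat \<Rightarrow> ('i \<Rightarrow> 'o) \<Rightarrow> ('j \<Rightarrow> 'm) \<Rightarrow> 'o \<Rightarrow> ('i \<Rightarrow> 'm) \<Rightarrow> bool" where
  "is_limit J C Fo Fa L p \<longleftrightarrow>
     is_cone J C Fo Fa L p \<and>
     (\<forall>M q. is_cone J C Fo Fa M q \<longrightarrow>
        (\<exists>!u. u \<in> Hom C M L \<and> (\<forall>x\<in>Obj J. p x \<bullet>\<^bsub>C\<^esub> u = q x)))"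

text \<open>Every finite category is isomorphic to one whose objects and arrows are natural numbers,
  so it is enough to consider diagrams of such shapes.\<close>

definition has_finite_limits :: "('o, 'm) cat \<Rightarrow> bool" where
  "has_finite_limits C \<longleftrightarrow>
     (\<forall>(J :: (nat, nat) cat) Fo Fa.
        category J \<and> finite (Obj J) \<and> finite (Arr J) \<and> is_functor J C Fo Fa \<longrightarrow>
        (\<exists>L p. is_limit J C Fo Fa L p))"

definition is_product :: "('o, 'm) cat \<Rightarrow> 'o \<Rightarrow> 'o \<Rightarrow> 'o \<Rightarrow> 'm \<Rightarrow> 'm \<Rightarrow> bool" where
  "is_product C A B P p q \<longleftrightarrow>
     p \<in> Hom C P A \<and> q \<in> Hom C P B \<and>
     (\<forall>X. \<forall>f \<in> Hom C X A. \<forall>g \<in> Hom C X B.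
        \<exists>!u. u \<in> Hom C X P \<and> p \<bullet>\<^bsub>C\<^esub> u = f \<and> q \<bullet>\<^bsub>C\<^esub> u = g)"

definition has_binary_products :: "('o, 'm) cat \<Rightarrow> bool" where
  "has_binary_products C \<longleftrightarrow> (\<forall>A\<in>Obj C. \<forall>B\<in>Obj C. \<exists>P p q. is_product C A B P p q)"

text \<open>Squares are given by their top, left, right and bottom sides, in this order; their corners are
  recovered as domains and codomains.\<close>

definition commutative_square :: "('o, 'm) cat \<Rightarrow> 'm \<Rightarrow> 'm \<Rightarrow> 'm \<Rightarrow> 'm \<Rightarrow> bool" where
  "commutative_square C t l r b \<longleftrightarrow>
     t \<in> Arr C \<and> l \<in> Arr C \<and> r \<in> Arr C \<and> b \<in> Arr C \<and>
     Dom C t = Dom C l \<and> Cod C t = Dom C r \<and>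
     Cod C l = Dom C b \<and> Cod C r = Cod C b \<and>
     r \<bullet>\<^bsub>C\<^esub> t = b \<bullet>\<^bsub>C\<^esub> l"

definition is_pullback :: "('o, 'm) cat \<Rightarrow> 'm \<Rightarrow> 'm \<Rightarrow> 'm \<Rightarrow> 'm \<Rightarrow> bool" where
  "is_pullback C t l r b \<longleftrightarrow>
     commutative_square C t l r b \<and>
     (\<forall>f g. commutative_square C f g r b \<longrightarrow>
        (\<exists>!u. u \<in> Hom C (Dom C f) (Dom C t) \<and> t \<bullet>\<^bsub>C\<^esub> u = f \<and> l \<bullet>\<^bsub>C\<^esub> u = g))"


section \<open>Monomorphisms, regular epimorphisms and feeble pullbacks\<close>

definition is_mono :: "('o, 'm) cat \<Rightarrow> 'm \<Rightarrow> bool" where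
  "is_mono C m \<longleftrightarrow>
     m \<in> Arr C \<and>
     (\<forall>X. \<forall>f \<in> Hom C X (Dom C m). \<forall>g \<in> Hom C X (Dom C m). m \<bullet>\<^bsub>C\<^esub> f = m \<bullet>\<^bsub>C\<^esub> g \<longrightarrow> f = g)"

definition is_coequalizer :: "('o, 'm) cat \<Rightarrow> 'm \<Rightarrow> 'm \<Rightarrow> 'm \<Rightarrow> bool" where
  "is_coequalizer C f g e \<longleftrightarrow>
     e \<in> Arr C \<and> f \<in> Hom C (Dom C f) (Dom C e) \<and> g \<in> Hom C (Dom C f) (Dom C e) \<and>
     e \<bullet>\<^bsub>C\<^esub> f = e \<bullet>\<^bsub>C\<^esub> g \<and>
     (\<forall>X. \<forall>h \<in> Hom C (Dom C e) X. h \<bullet>\<^bsub>C\<^esub> f = h \<bullet>\<^bsub>C\<^esub> g \<longrightarrow>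
        (\<exists>!u. u \<in> Hom C (Cod C e) X \<and> u \<bullet>\<^bsub>C\<^esub> e = h))"

definition is_regular_epi :: "('o, 'm) cat \<Rightarrow> 'm \<Rightarrow> bool" where
  "is_regular_epi C e \<longleftrightarrow> (\<exists>f g. is_coequalizer C f g e)"

text \<open>Pullbacks are unique up to isomorphism and regular epimorphisms are stable under
  composition with isomorphisms, so it does not matter which pullback \<open>p, q\<close> is used.\<close>

definition is_feeble_pullback :: "('o, 'm) cat \<Rightarrow> 'm \<Rightarrow> 'm \<Rightarrow> 'm \<Rightarrow> 'm \<Rightarrow> bool" where
  "is_feeble_pullback C t l r b \<longleftrightarrow>
     commutative_square C t l r b \<and>
     (\<exists>p q u. is_pullback C p q r b \<and>
        u \<in> Hom C (Dom C t) (Dom C p) \<and> p \<bullet>\<^bsub>C\<^esub> u = t \<and> q \<bullet>\<^bsub>C\<^esub> u = l \<and>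
        is_regular_epi C u)"


section \<open>Coproducts\<close>

definition is_family_coproduct ::
  "('o, 'm) cat \<Rightarrow> 'i set \<Rightarrow> ('i \<Rightarrow> 'o) \<Rightarrow> 'o \<Rightarrow> ('i \<Rightarrow> 'm) \<Rightarrow> bool" where
  "is_family_coproduct C I X K \<iota> \<longleftrightarrow>
     K \<in> Obj C \<and> (\<forall>i\<in>I. \<iota> i \<in> Hom C (X i) K) \<and>
     (\<forall>Y\<in>Obj C. \<forall>f. (\<forall>i\<in>I. f i \<in> Hom C (X i) Y) \<longrightarrow>
        (\<exists>!u. u \<in> Hom C K Y \<and> (\<forall>i\<in>I. u \<bullet>\<^bsub>C\<^esub> \<iota> i = f i)))"

definition has_finite_coproducts :: "('o, 'm) cat \<Rightarrow> bool" where
  "has_finite_coproducts C \<longleftrightarrow>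
     (\<forall>n (X :: nat \<Rightarrow> 'o). (\<forall>i<n. X i \<in> Obj C) \<longrightarrow>
        (\<exists>K \<iota>. is_family_coproduct C {..<n} X K \<iota>))"

definition is_coproduct :: "('o, 'm) cat \<Rightarrow> 'o \<Rightarrow> 'o \<Rightarrow> 'o \<Rightarrow> 'm \<Rightarrow> 'm \<Rightarrow> bool" where
  "is_coproduct C A B K i j \<longleftrightarrow>
     i \<in> Hom C A K \<and> j \<in> Hom C B K \<and>
     (\<forall>X. \<forall>f \<in> Hom C A X. \<forall>g \<in> Hom C B X.
        \<exists>!u. u \<in> Hom C K X \<and> u \<bullet>\<^bsub>C\<^esub> i = f \<and> u \<bullet>\<^bsub>C\<^esub> j = g)"

text \<open>A choice of binary coproducts: \<open>inl A B\<close> and \<open>inr A B\<close> are the injections of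
  \<open>A\<close> and \<open>B\<close> into the chosen \<open>A + B\<close>, which is their common codomain.\<close>

definition coproduct_choice ::
  "('o, 'm) cat \<Rightarrow> ('o \<Rightarrow> 'o \<Rightarrow> 'm) \<Rightarrow> ('o \<Rightarrow> 'o \<Rightarrow> 'm) \<Rightarrow> bool" where
  "coproduct_choice C inl inr \<longleftrightarrow>
     (\<forall>A\<in>Obj C. \<forall>B\<in>Obj C. is_coproduct C A B (Cod C (inl A B)) (inl A B) (inr A B))"

text \<open>The morphism \<open>[f, g] : A + B \<rightarrow> X\<close> for \<open>f : A \<rightarrow> X\<close> and \<open>g : B \<rightarrow> X\<close>.\<close>

definition copair ::
  "('o, 'm) cat \<Rightarrow> ('o \<Rightarrow> 'o \<Rightarrow> 'm) \<Rightarrow> ('o \<Rightarrow> 'o \<Rightarrow> 'm) \<Rightarrow> 'm \<Rightarrow> 'm \<Rightarrow> 'm" where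
  "copair C inl inr f g =
     (THE u. u \<in> Hom C (Cod C (inl (Dom C f) (Dom C g))) (Cod C f) \<and>
        u \<bullet>\<^bsub>C\<^esub> inl (Dom C f) (Dom C g) = f \<and> u \<bullet>\<^bsub>C\<^esub> inr (Dom C f) (Dom C g) = g)"

text \<open>The morphism \<open>f + g : A + B \<rightarrow> A' + B'\<close> for \<open>f : A \<rightarrow> A'\<close> and \<open>g : B \<rightarrow> B'\<close>.\<close>

definition coprod_map ::
  "('o, 'm) cat \<Rightarrow> ('o \<Rightarrow> 'o \<Rightarrow> 'm) \<Rightarrow> ('o \<Rightarrow> 'o \<Rightarrow> 'm) \<Rightarrow> 'm \<Rightarrow> 'm \<Rightarrow> 'm" where
  "coprod_map C inl inr f g =
     copair C inl inr (inl (Cod C f) (Cod C g) \<bullet>\<^bsub>C\<^esub> f) (inr (Cod C f) (Cod C g) \<bullet>\<^bsub>C\<^esub> g)"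


section \<open>Pointed and additive categories, Condition P\<close>

definition is_zero_object :: "('o, 'm) cat \<Rightarrow> 'o \<Rightarrow> bool" where
  "is_zero_object C Z \<longleftrightarrow>
     Z \<in> Obj C \<and> (\<forall>A\<in>Obj C. (\<exists>!f. f \<in> Hom C Z A) \<and> (\<exists>!f. f \<in> Hom C A Z))"

definition is_pointed :: "('o, 'm) cat \<Rightarrow> bool" where
  "is_pointed C \<longleftrightarrow> (\<exists>Z. is_zero_object C Z)"

text \<open>The group operation on \<open>Hom C A B\<close> is the (multiplicatively written) operation of
  the group \<open>G A B\<close>.\<close>

definition is_additive :: "('o, 'm) cat \<Rightarrow> bool" where
  "is_additive C \<longleftrightarrow>
     is_pointed C \<and> has_binary_products C \<and>
     (\<exists>G :: 'o \<Rightarrow> 'o \<Rightarrow> 'm monoid.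
        (\<forall>A\<in>Obj C. \<forall>B\<in>Obj C. comm_group (G A B) \<and> carrier (G A B) = Hom C A B) \<and>
        (\<forall>A\<in>Obj C. \<forall>B\<in>Obj C. \<forall>D\<in>Obj C.
           (\<forall>f \<in> Hom C A B. \<forall>g \<in> Hom C B D. \<forall>g' \<in> Hom C B D.
              (g \<otimes>\<^bsub>G B D\<^esub> g') \<bullet>\<^bsub>C\<^esub> f = (g \<bullet>\<^bsub>C\<^esub> f) \<otimes>\<^bsub>G A D\<^esub> (g' \<bullet>\<^bsub>C\<^esub> f)) \<and>
           (\<forall>f \<in> Hom C A B. \<forall>f' \<in> Hom C A B. \<forall>g \<in> Hom C B D.
              g \<bullet>\<^bsub>C\<^esub> (f \<otimes>\<^bsub>G A B\<^esub> f') = (g \<bullet>\<^bsub>C\<^esub> f) \<otimes>\<^bsub>G A D\<^esub> (g \<bullet>\<^bsub>C\<^esub> f'))))"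

text \<open>In (b), (c) and (d) the choice of coproducts is immaterial up to isomorphism; the
  conditions are required for every choice, and choices exist by (a).\<close>

definition condition_b ::
  "('o, 'm) cat \<Rightarrow> ('o \<Rightarrow> 'o \<Rightarrow> 'm) \<Rightarrow> ('o \<Rightarrow> 'o \<Rightarrow> 'm) \<Rightarrow> bool" where
  "condition_b C inl inr \<longleftrightarrow>
     (\<forall>t l r b t' l' r' b'. is_pullback C t l r b \<and> is_pullback C t' l' r' b' \<longrightarrow>
        is_pullback C (coprod_map C inl inr t t') (coprod_map C inl inr l l')
          (coprod_map C inl inr r r') (coprod_map C inl inr b b'))"

definition condition_c ::
  "('o, 'm) cat \<Rightarrow> ('o \<Rightarrow> 'o \<Rightarrow> 'm) \<Rightarrow> ('o \<Rightarrow> 'o \<Rightarrow> 'm) \<Rightarrow> bool" where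
  "condition_c C inl inr \<longleftrightarrow>
     (\<forall>S A m. m \<in> Hom C S A \<and> is_mono C m \<longrightarrow>
        is_pullback C (coprod_map C inl inr m (Id C S)) (copair C inl inr (Id C S) (Id C S))
          (copair C inl inr (Id C A) m) m)"

definition condition_d ::
  "('o, 'm) cat \<Rightarrow> ('o \<Rightarrow> 'o \<Rightarrow> 'm) \<Rightarrow> ('o \<Rightarrow> 'o \<Rightarrow> 'm) \<Rightarrow> bool" where
  "condition_d C inl inr \<longleftrightarrow>
     (\<forall>E B p. p \<in> Hom C E B \<and> is_regular_epi C p \<longrightarrow>
        is_feeble_pullback C (coprod_map C inl inr p p) (copair C inl inr (Id C E) (Id C E))
          (copair C inl inr (Id C B) (Id C B)) p)"

definition condition_P :: "('o, 'm) cat \<Rightarrow> bool" where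
  "condition_P C \<longleftrightarrow>
     has_finite_coproducts C \<and>
     (\<forall>inl inr. coproduct_choice C inl inr \<longrightarrow>
        condition_b C inl inr \<and> condition_c C inl inr \<and> condition_d C inl inr)"

end

theory Submission
  imports Defs
begin

text \<open>Condition (b), applied to the pullback squares exhibiting \<open>A\<close> and \<open>B\<close> as products with \<open>0\<close>,
  makes binary coproducts biproducts, so the hom-sets are commutative monoids. Condition (c) says
  that subobjects are subtractive: \<open>x + s \<in> S\<close> and \<open>s \<in> S\<close> imply \<open>x \<in> S\<close>. For the diagonal this
  is cancellation, which makes \<open>(x, y) \<mapsto> (x, x + y)\<close> a monomorphism; subtractivity of the latter
  produces negatives.

  Conversely, in an additive category the pullback in (d) is \<open>B \<oplus> E\<close>, with the shear
  \<open>(b, e) \<mapsto> (b, p e - b)\<close> as its map to \<open>B \<oplus> B\<close>, and the comparison map is \<open>p \<oplus> 1\<close> up to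
  isomorphism.\<close>

section \<open>Categories with coproducts and zero morphisms\<close>

text \<open>Condition P mentions no operation on arrows, so zero morphisms and addition have to be
  built from the zero object and the coproducts; in the converse direction both come from the given
  hom-groups. The locales therefore treat \<open>zm\<close> and \<open>add\<close> abstractly, and
  both directions share one calculus, in which an arrow into \<open>A + B\<close> is handled through
  its coordinates \<open>pr1\<close> and \<open>pr2\<close>, as a generalized element (x, y).

  Subtractivity speaks only about monomorphisms, and (x, y) \<mapsto> (x, x + y) is one exactly when
  addition is cancellative. This forces the detour through the diagonal, which is a monomorphism in
  any case because a projection splits it.\<close>

context category
begin

lemma Hom_iff: "f \<in> Hom C A B \<longleftrightarrow> f \<in> Arr C \<and> Dom C f = A \<and> Cod C f = B"
  by (simp add: Hom_def)

lemma Dom_in_Obj [simp]: "f \<in> Arr C \<Longrightarrow> Dom C f \<in> Obj C"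
  by (rule Dom_Obj)

lemma Cod_in_Obj [simp]: "f \<in> Arr C \<Longrightarrow> Cod C f \<in> Obj C"
  by (rule Cod_Obj)

lemma Id_simps [simp]:
  assumes "A \<in> Obj C"
  shows "Id C A \<in> Arr C" "Dom C (Id C A) = A" "Cod C (Id C A) = A"
  using Id_Hom[OF assms] by (auto simp: Hom_iff)

lemma Comp_simps [simp]:
  assumes "f \<in> Arr C" "g \<in> Arr C" "Cod C f = Dom C g"
  shows "g \<bullet> f \<in> Arr C" "Dom C (g \<bullet> f) = Dom C f" "Cod C (g \<bullet> f) = Cod C g"
  using Comp_Hom[of f "Dom C f" "Cod C f" g "Cod C g"] assms by (auto simp: Hom_iff)

lemma Comp_assoc_Arr [simp]:
  "f \<in> Arr C \<Longrightarrow> g \<in> Arr C \<Longrightarrow> h \<in> Arr C \<Longrightarrow> Cod C f = Dom C g \<Longrightarrow> Cod C g = Dom C h \<Longrightarrow>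
    (h \<bullet> g) \<bullet> f = h \<bullet> (g \<bullet> f)"
  by (rule Comp_assoc) (auto simp: Hom_iff)

lemma Id_left_Arr [simp]: "f \<in> Arr C \<Longrightarrow> Cod C f = B \<Longrightarrow> Id C B \<bullet> f = f"
  by (rule Id_left) (auto simp: Hom_iff)

lemma Id_right_Arr [simp]: "f \<in> Arr C \<Longrightarrow> Dom C f = A \<Longrightarrow> f \<bullet> Id C A = f"
  by (rule Id_right) (auto simp: Hom_iff)

text \<open>Composites are normalized to the right, which hides the left side of
  \<open>g \<bullet> f = k\<close> inside \<open>g \<bullet> (f \<bullet> h)\<close>. The
  \<open>_assoc\<close> variants of later rewrite rules are obtained from this form.\<close>

lemma Comp_eq_assoc:
  assumes "g \<bullet> f = k" "f \<in> Arr C" "g \<in> Arr C" "h \<in> Arr C" "Cod C h = Dom C f" "Cod C f = Dom C g"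
  shows "g \<bullet> (f \<bullet> h) = k \<bullet> h"
  using Comp_assoc_Arr[OF assms(4,2,3,5,6)] unfolding assms(1) by (rule sym)

lemma pullback_ex1:
  assumes "is_pullback C t l r b" "commutative_square C f g r b"
  shows "\<exists>!u. u \<in> Hom C (Dom C f) (Dom C t) \<and> t \<bullet> u = f \<and> l \<bullet> u = g"
  using assms unfolding is_pullback_def by blast

section \<open>Choices of coproducts; binary and finite coproducts\<close>

lemma coproduct_choice_exists:
  assumes "\<And>A B. A \<in> Obj C \<Longrightarrow> B \<in> Obj C \<Longrightarrow> \<exists>K i j. is_coproduct C A B K i j"
  shows "\<exists>inl inr. coproduct_choice C inl inr"
proof -
  \<comment> \<open>A choice stores the coproduct object only as the codomain of \<open>inl\<close>,
    so \<open>K\<close> is replaced by \<open>Cod C i\<close>. The membership conditions sit under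
    the existential so that choice functions exist on all of the object type.\<close>
  have "\<exists>i j. A \<in> Obj C \<longrightarrow> B \<in> Obj C \<longrightarrow> is_coproduct C A B (Cod C i) i j" for A B
  proof -
    have "Cod C i = K" if "is_coproduct C A B K i j" for K i j
      using that by (simp add: is_coproduct_def Hom_iff)
    then show ?thesis
      using assms[of A B] by blast
  qed
  then obtain inl inr where
    "\<And>A B. A \<in> Obj C \<Longrightarrow> B \<in> Obj C \<Longrightarrow> is_coproduct C A B (Cod C (inl A B)) (inl A B) (inr A B)"
    by metis
  then show ?thesis
    unfolding coproduct_choice_def by blast
qed

lemma binary_coproduct_of_finite_coproducts:
  assumes fc: "has_finite_coproducts C" and A: "A \<in> Obj C" and B: "B \<in> Obj C"
  shows "\<exists>K i j. is_coproduct C A B K i j"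
proof -
  define X :: "nat \<Rightarrow> 'o" where "X = (\<lambda>n. if n = 0 then A else B)"
  have "\<forall>i<2. X i \<in> Obj C"
    using A B by (simp add: X_def)
  then obtain K \<iota> where K: "is_family_coproduct C {..<2} X K \<iota>"
    using fc unfolding has_finite_coproducts_def by blast
  have lt2: "i \<in> {..<2} \<longleftrightarrow> i = 0 \<or> i = 1" for i :: nat by auto
  have ball2: "(\<forall>i\<in>{..<2}. P i) \<longleftrightarrow> P 0 \<and> P (1::nat)" for P
    unfolding lt2 Ball_def by auto
  have in0: "\<iota> 0 \<in> Hom C A K" and in1: "\<iota> 1 \<in> Hom C B K"
    using K unfolding is_family_coproduct_def ball2 by (auto simp: X_def)
  have "is_coproduct C A B K (\<iota> 0) (\<iota> 1)"
    unfolding is_coproduct_def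
  proof (intro conjI in0 in1 allI ballI)
    fix Y f g assume f: "f \<in> Hom C A Y" and g: "g \<in> Hom C B Y"
    have Y: "Y \<in> Obj C"
      using f Cod_Obj by (auto simp: Hom_iff)
    define h where "h = (\<lambda>n::nat. if n = 0 then f else g)"
    have "\<forall>i\<in>{..<2}. h i \<in> Hom C (X i) Y"
      using f g by (simp add: h_def X_def)
    then have "\<exists>!u. u \<in> Hom C K Y \<and> (\<forall>i\<in>{..<2}. u \<bullet> \<iota> i = h i)"
      using K Y unfolding is_family_coproduct_def by blast
    then show "\<exists>!u. u \<in> Hom C K Y \<and> u \<bullet> \<iota> 0 = f \<and> u \<bullet> \<iota> 1 = g"
      unfolding ball2 by (simp add: h_def)
  qed
  then show ?thesis by blast
qed

text \<open>Induction on the length of the family: the initial object serves the empty family, and a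
  sum of n objects is extended by one binary coproduct with the next object.\<close>

lemma finite_coproducts_of_binary:
  assumes Z: "Z \<in> Obj C" and init: "\<And>A. A \<in> Obj C \<Longrightarrow> \<exists>!f. f \<in> Hom C Z A"
    and bin: "\<And>A B. A \<in> Obj C \<Longrightarrow> B \<in> Obj C \<Longrightarrow> \<exists>K i j. is_coproduct C A B K i j"
  shows "has_finite_coproducts C"
proof -
  have "\<exists>K \<iota>. is_family_coproduct C {..<n} X K \<iota>" if "\<forall>i<n. X i \<in> Obj C" for n and X :: "nat \<Rightarrow> 'o"
    using that
  proof (induction n)
    case 0
    \<comment> \<open>An empty family has no injections, so \<open>Id C Z\<close> is only a filler
      value.\<close>
    have "is_family_coproduct C {..<0} X Z (\<lambda>_. Id C Z)"
      using Z init by (simp add: is_family_coproduct_def)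
    then show ?case by blast
  next
    case (Suc n)
    then obtain K \<iota> where K: "is_family_coproduct C {..<n} X K \<iota>" by auto
    then have KO: "K \<in> Obj C" by (simp add: is_family_coproduct_def)
    obtain L i j where L: "is_coproduct C K (X n) L i j"
      using bin[OF KO, of "X n"] Suc.prems by auto
    then have i: "i \<in> Hom C K L" and j: "j \<in> Hom C (X n) L"
      by (auto simp: is_coproduct_def)
    have \<iota>: "\<iota> k \<in> Hom C (X k) K" if "k < n" for k
      using K that by (simp add: is_family_coproduct_def)
    define \<kappa> where "\<kappa> = (\<lambda>k. if k = n then j else i \<bullet> \<iota> k)"
    have \<kappa>n: "\<kappa> n = j" and \<kappa>: "\<And>k. k < n \<Longrightarrow> \<kappa> k = i \<bullet> \<iota> k"
      by (auto simp: \<kappa>_def)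
    have "is_family_coproduct C {..<Suc n} X L \<kappa>"
      unfolding is_family_coproduct_def
    proof (intro conjI ballI allI impI)
      show "L \<in> Obj C" using i by (auto simp: Hom_iff)
      show "\<kappa> k \<in> Hom C (X k) L" if "k \<in> {..<Suc n}" for k
        using that j Comp_Hom[OF \<iota> i] by (auto simp: \<kappa>_def)
      fix Y f assume Y: "Y \<in> Obj C" and f: "\<forall>k\<in>{..<Suc n}. f k \<in> Hom C (X k) Y"
      obtain v where v: "v \<in> Hom C K Y" "\<forall>k\<in>{..<n}. v \<bullet> \<iota> k = f k"
        and v_unique: "\<And>w. w \<in> Hom C K Y \<Longrightarrow> \<forall>k\<in>{..<n}. w \<bullet> \<iota> k = f k \<Longrightarrow> w = v"
        using K Y f unfolding is_family_coproduct_def by (metis lessThan_iff less_Suc_eq)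
      have fn: "f n \<in> Hom C (X n) Y"
        using f by simp
      then obtain u where u: "u \<in> Hom C L Y" "u \<bullet> i = v" "u \<bullet> j = f n"
        and u_unique: "\<And>w. w \<in> Hom C L Y \<Longrightarrow> w \<bullet> i = v \<Longrightarrow> w \<bullet> j = f n \<Longrightarrow> w = u"
        using L v(1) unfolding is_coproduct_def by metis
      \<comment> \<open>This separates the n + 1 conditions into those governed by the universal
        property of \<open>K\<close>, through \<open>w \<bullet> i\<close>, and the last one; the
        universal property of \<open>L\<close> joins the two.\<close>
      have split: "(\<forall>k\<in>{..<Suc n}. w \<bullet> \<kappa> k = f k) \<longleftrightarrow>
          (\<forall>k\<in>{..<n}. (w \<bullet> i) \<bullet> \<iota> k = f k) \<and> w \<bullet> j = f n" if w: "w \<in> Hom C L Y" for w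
      proof -
        have "w \<bullet> \<kappa> k = (w \<bullet> i) \<bullet> \<iota> k" if "k < n" for k
          using Comp_assoc[OF \<iota>[OF that] i w] unfolding \<kappa>[OF that] by (rule sym)
        then show ?thesis
          using \<kappa>n by (auto simp: less_Suc_eq simp del: Comp_assoc_Arr)
      qed
      show "\<exists>!u. u \<in> Hom C L Y \<and> (\<forall>k\<in>{..<Suc n}. u \<bullet> \<kappa> k = f k)"
      proof (rule ex1I[of _ u])
        show "u \<in> Hom C L Y \<and> (\<forall>k\<in>{..<Suc n}. u \<bullet> \<kappa> k = f k)"
          using u v split[of u] by simp
        fix w assume "w \<in> Hom C L Y \<and> (\<forall>k\<in>{..<Suc n}. w \<bullet> \<kappa> k = f k)"
        then show "w = u"
          using split[of w] v_unique[of "w \<bullet> i"] u_unique[of w] Comp_Hom[OF i, of w Y] by simp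
      qed
    qed
    then show ?case by blast
  qed
  then show ?thesis
    unfolding has_finite_coproducts_def by blast
qed

end

text \<open>The choice is a parameter because Condition P quantifies over all choices: one direction
  instantiates it with some choice, the other must accept an arbitrary one.\<close>

locale coproduct_category = category C for C :: "('o, 'm) cat" (structure) +
  fixes inl inr :: "'o \<Rightarrow> 'o \<Rightarrow> 'm"
  assumes choice: "coproduct_choice C inl inr"
begin

abbreviation cp :: "'m \<Rightarrow> 'm \<Rightarrow> 'm" where "cp \<equiv> copair C inl inr"
abbreviation cmap :: "'m \<Rightarrow> 'm \<Rightarrow> 'm" where "cmap \<equiv> coprod_map C inl inr"

lemma is_coproduct_inl_inr:
  "A \<in> Obj C \<Longrightarrow> B \<in> Obj C \<Longrightarrow> is_coproduct C A B (Cod C (inl A B)) (inl A B) (inr A B)"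
  using choice by (simp add: coproduct_choice_def)

lemma inj_simps [simp]:
  assumes "A \<in> Obj C" "B \<in> Obj C"
  shows "inl A B \<in> Arr C" "Dom C (inl A B) = A"
    "inr A B \<in> Arr C" "Dom C (inr A B) = B" "Cod C (inr A B) = Cod C (inl A B)"
  using is_coproduct_inl_inr[OF assms] by (auto simp: is_coproduct_def Hom_iff)

lemma copair_THE:
  assumes "f \<in> Arr C" "g \<in> Arr C" "Cod C f = Cod C g"
  shows "\<exists>!u. u \<in> Hom C (Cod C (inl (Dom C f) (Dom C g))) (Cod C f) \<and>
    u \<bullet> inl (Dom C f) (Dom C g) = f \<and> u \<bullet> inr (Dom C f) (Dom C g) = g"
  using is_coproduct_inl_inr[of "Dom C f" "Dom C g"] assms by (simp add: is_coproduct_def Hom_iff)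

lemma copair_simps [simp]:
  assumes "f \<in> Arr C" "g \<in> Arr C" "Cod C f = Cod C g"
  shows "cp f g \<in> Arr C" "Dom C (cp f g) = Cod C (inl (Dom C f) (Dom C g))" "Cod C (cp f g) = Cod C g"
  using theI'[OF copair_THE[OF assms]] assms(3) unfolding copair_def Hom_iff by simp_all

lemma copair_inj [simp]:
  assumes "f \<in> Arr C" "g \<in> Arr C" "Cod C f = Cod C g" "Dom C f = A" "Dom C g = B"
  shows "cp f g \<bullet> inl A B = f" "cp f g \<bullet> inr A B = g"
  using theI'[OF copair_THE[OF assms(1-3)]] unfolding copair_def assms(4,5) by simp_all

lemma copair_inj_assoc [simp]:
  assumes "f \<in> Arr C" "g \<in> Arr C" "Cod C f = Cod C g" "Dom C f = A" "Dom C g = B" "h \<in> Arr C"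
  shows "Cod C h = A \<Longrightarrow> cp f g \<bullet> (inl A B \<bullet> h) = f \<bullet> h" "Cod C h = B \<Longrightarrow> cp f g \<bullet> (inr A B \<bullet> h) = g \<bullet> h"
  using assms by (auto intro!: Comp_eq_assoc)

lemma coprod_eqI:
  assumes "u \<in> Arr C" "v \<in> Arr C" "Dom C u = Cod C (inl A B)" "Dom C v = Cod C (inl A B)"
    "A \<in> Obj C" "B \<in> Obj C" "u \<bullet> inl A B = v \<bullet> inl A B" "u \<bullet> inr A B = v \<bullet> inr A B"
  shows "u = v"
proof -
  \<comment> \<open>The common codomain is read off the equal composites; it places \<open>u\<close>
    and \<open>v\<close> in one hom-set, where uniqueness applies.\<close>
  have "Cod C (u \<bullet> inl A B) = Cod C (v \<bullet> inl A B)"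
    using assms(7) by simp
  then have cod: "Cod C v = Cod C u"
    using assms(1-6) by simp
  have "u \<bullet> inl A B \<in> Hom C A (Cod C u)" "u \<bullet> inr A B \<in> Hom C B (Cod C u)"
    using assms(1-6) by (auto simp: Hom_iff)
  then have "\<exists>!w. w \<in> Hom C (Cod C (inl A B)) (Cod C u) \<and> w \<bullet> inl A B = u \<bullet> inl A B \<and> w \<bullet> inr A B = u \<bullet> inr A B"
    using is_coproduct_inl_inr[OF assms(5,6)] unfolding is_coproduct_def by blast
  moreover have "u \<in> Hom C (Cod C (inl A B)) (Cod C u)" "v \<in> Hom C (Cod C (inl A B)) (Cod C u)"
    using assms(1-4) cod by (auto simp: Hom_iff)
  ultimately show ?thesis
    using assms(7,8) by metis
qed

lemma cmap_simps [simp]: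
  assumes "f \<in> Arr C" "g \<in> Arr C"
  shows "cmap f g \<in> Arr C" "Dom C (cmap f g) = Cod C (inl (Dom C f) (Dom C g))"
    "Cod C (cmap f g) = Cod C (inl (Cod C f) (Cod C g))"
  using assms by (simp_all add: coprod_map_def)

lemma cmap_inj [simp]:
  assumes "f \<in> Arr C" "g \<in> Arr C" "Dom C f = A" "Dom C g = B"
  shows "cmap f g \<bullet> inl A B = inl (Cod C f) (Cod C g) \<bullet> f" "cmap f g \<bullet> inr A B = inr (Cod C f) (Cod C g) \<bullet> g"
  using assms by (auto simp: coprod_map_def)

lemma cmap_inj_assoc [simp]:
  assumes "f \<in> Arr C" "g \<in> Arr C" "Dom C f = A" "Dom C g = B" "h \<in> Arr C"
  shows "Cod C h = A \<Longrightarrow> cmap f g \<bullet> (inl A B \<bullet> h) = inl (Cod C f) (Cod C g) \<bullet> (f \<bullet> h)"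
    "Cod C h = B \<Longrightarrow> cmap f g \<bullet> (inr A B \<bullet> h) = inr (Cod C f) (Cod C g) \<bullet> (g \<bullet> h)"
  using Comp_eq_assoc[OF cmap_inj(1)[OF assms(1-4)], of h] Comp_eq_assoc[OF cmap_inj(2)[OF assms(1-4)], of h]
    assms by auto

end

text \<open>The absorption laws are axiomatized without a zero object, since \<open>zm\<close> has
  two origins: arrows factoring through a zero object, and the units of the hom-groups.\<close>

locale zero_category = category C for C :: "('o, 'm) cat" (structure) +
  fixes zm :: "'o \<Rightarrow> 'o \<Rightarrow> 'm"
  assumes zm_simps [simp]: "A \<in> Obj C \<Longrightarrow> B \<in> Obj C \<Longrightarrow> zm A B \<in> Arr C"
      "A \<in> Obj C \<Longrightarrow> B \<in> Obj C \<Longrightarrow> Dom C (zm A B) = A"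
      "A \<in> Obj C \<Longrightarrow> B \<in> Obj C \<Longrightarrow> Cod C (zm A B) = B"
    and zm_comp [simp]: "f \<in> Arr C \<Longrightarrow> Cod C f = A \<Longrightarrow> B \<in> Obj C \<Longrightarrow> zm A B \<bullet> f = zm (Dom C f) B"
    and comp_zm [simp]: "f \<in> Arr C \<Longrightarrow> Dom C f = B \<Longrightarrow> A \<in> Obj C \<Longrightarrow> f \<bullet> zm A B = zm A (Cod C f)"

text \<open>The zero morphism is the composite through \<open>Z\<close>. Absorption on either side
  is the uniqueness of arrows into and out of \<open>Z\<close>.\<close>

lemma (in category) zero_morphisms_exist:
  assumes "is_zero_object C Z"
  shows "\<exists>zm. zero_category C zm"
proof -
  have Z: "Z \<in> Obj C" using assms by (simp add: is_zero_object_def)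
  obtain a where a: "\<And>A. A \<in> Obj C \<Longrightarrow> a A \<in> Hom C Z A" "\<And>A f. A \<in> Obj C \<Longrightarrow> f \<in> Hom C Z A \<Longrightarrow> f = a A"
    using assms unfolding is_zero_object_def by metis
  obtain c where c: "\<And>A. A \<in> Obj C \<Longrightarrow> c A \<in> Hom C A Z" "\<And>A f. A \<in> Obj C \<Longrightarrow> f \<in> Hom C A Z \<Longrightarrow> f = c A"
    using assms unfolding is_zero_object_def by metis
  have [simp]: "a A \<in> Arr C" "Dom C (a A) = Z" "Cod C (a A) = A"
      "c A \<in> Arr C" "Dom C (c A) = A" "Cod C (c A) = Z" if "A \<in> Obj C" for A
    using a(1)[OF that] c(1)[OF that] by (auto simp: Hom_iff)
  have "c A \<bullet> f = c (Dom C f)" if "f \<in> Arr C" "Cod C f = A" for A f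
    using that by (intro c(2)) (auto simp: Hom_iff)
  moreover have "f \<bullet> a A = a (Cod C f)" if "f \<in> Arr C" "Dom C f = A" for A f
    using that Z by (intro a(2)) (auto simp: Hom_iff)
  moreover have "f \<bullet> (a B \<bullet> c A) = a (Cod C f) \<bullet> c A"
    if "f \<in> Arr C" "Dom C f = B" "A \<in> Obj C" for f A B
    using that calculation(2)[of f B] by (intro Comp_eq_assoc) auto
  ultimately have "zero_category C (\<lambda>A B. a B \<bullet> c A)"
    by unfold_locales auto
  then show ?thesis by blast
qed

section \<open>Projections of coproducts, and products from clause (b)\<close>

locale zero_coproduct_category = zero_category C zm + coproduct_category C inl inr
  for C :: "('o, 'm) cat" (structure) and zm inl inr
begin

text \<open>These are the retractions [1, 0] and [0, 1] of the injections, available as soon as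
  there are zero morphisms; that they are product projections is a separate matter.\<close>

definition pr1 :: "'o \<Rightarrow> 'o \<Rightarrow> 'm" where "pr1 A B = cp (Id C A) (zm B A)"
definition pr2 :: "'o \<Rightarrow> 'o \<Rightarrow> 'm" where "pr2 A B = cp (zm A B) (Id C B)"

lemma pr_simps [simp]:
  assumes "A \<in> Obj C" "B \<in> Obj C"
  shows "pr1 A B \<in> Arr C" "Dom C (pr1 A B) = Cod C (inl A B)" "Cod C (pr1 A B) = A"
    "pr2 A B \<in> Arr C" "Dom C (pr2 A B) = Cod C (inl A B)" "Cod C (pr2 A B) = B"
  using assms by (simp_all add: pr1_def pr2_def)

lemma pr_inj [simp]:
  assumes "A \<in> Obj C" "B \<in> Obj C"
  shows "pr1 A B \<bullet> inl A B = Id C A" "pr1 A B \<bullet> inr A B = zm B A"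
    "pr2 A B \<bullet> inl A B = zm A B" "pr2 A B \<bullet> inr A B = Id C B"
  using assms by (simp_all add: pr1_def pr2_def)

lemma pr_inj_assoc [simp]:
  assumes "A \<in> Obj C" "B \<in> Obj C" "h \<in> Arr C"
  shows "Cod C h = A \<Longrightarrow> pr1 A B \<bullet> (inl A B \<bullet> h) = h" "Cod C h = B \<Longrightarrow> pr1 A B \<bullet> (inr A B \<bullet> h) = zm (Dom C h) A"
    "Cod C h = A \<Longrightarrow> pr2 A B \<bullet> (inl A B \<bullet> h) = zm (Dom C h) B" "Cod C h = B \<Longrightarrow> pr2 A B \<bullet> (inr A B \<bullet> h) = h"
  using assms by (simp_all add: pr1_def pr2_def)

lemma pr_cmap [simp]:
  assumes "f \<in> Arr C" "g \<in> Arr C" "Cod C f = A" "Cod C g = B"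
  shows "pr1 A B \<bullet> cmap f g = f \<bullet> pr1 (Dom C f) (Dom C g)" "pr2 A B \<bullet> cmap f g = g \<bullet> pr2 (Dom C f) (Dom C g)"
proof -
  have "A \<in> Obj C" "B \<in> Obj C" using assms by auto
  then show "pr1 A B \<bullet> cmap f g = f \<bullet> pr1 (Dom C f) (Dom C g)" "pr2 A B \<bullet> cmap f g = g \<bullet> pr2 (Dom C f) (Dom C g)"
    by (rule_tac [!] coprod_eqI[of _ _ "Dom C f" "Dom C g"]) (use assms in simp_all)
qed

lemma pr_cmap_assoc [simp]:
  assumes "f \<in> Arr C" "g \<in> Arr C" "Cod C f = A" "Cod C g = B" "h \<in> Arr C" "Cod C h = Cod C (inl (Dom C f) (Dom C g))"
  shows "pr1 A B \<bullet> (cmap f g \<bullet> h) = f \<bullet> (pr1 (Dom C f) (Dom C g) \<bullet> h)"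
    "pr2 A B \<bullet> (cmap f g \<bullet> h) = g \<bullet> (pr2 (Dom C f) (Dom C g) \<bullet> h)"
  using Comp_eq_assoc[OF pr_cmap(1)[OF assms(1-4)], of h] Comp_eq_assoc[OF pr_cmap(2)[OF assms(1-4)], of h] assms
  by auto

text \<open>\<open>A + B\<close> is the coproduct of the pullback squares that exhibit \<open>A\<close> as \<open>A \<times> 0\<close> and \<open>B\<close> as
  \<open>0 \<times> B\<close> over \<open>0\<close>.\<close>

lemma is_product_if_condition_b:
  assumes Z: "is_zero_object C Z" and b: "condition_b C inl inr" and A: "A \<in> Obj C" and B: "B \<in> Obj C"
  shows "is_product C A B (Cod C (inl A B)) (pr1 A B) (pr2 A B)"
proof -
  have ZO: "Z \<in> Obj C" using Z by (simp add: is_zero_object_def)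
  have into_Z: "f = g" if "f \<in> Arr C" "g \<in> Arr C" "Cod C f = Z" "Cod C g = Z" "Dom C f = Dom C g" for f g
  proof -
    have "\<exists>!h. h \<in> Hom C (Dom C f) Z" using Z that by (simp add: is_zero_object_def)
    then show ?thesis using that by (auto simp: Hom_iff)
  qed
  have from_Z: "f = zm Z A" if "f \<in> Hom C Z A" "A \<in> Obj C" for f A
  proof -
    have "\<exists>!g. g \<in> Hom C Z A" using Z that by (simp add: is_zero_object_def)
    then show ?thesis using that ZO by (auto simp: Hom_iff)
  qed
  have pbA: "is_pullback C (Id C A) (zm A Z) (zm A Z) (Id C Z)"
    unfolding is_pullback_def commutative_square_def
  proof (intro conjI allI impI, goal_cases)
    case (10 f g)
    then have f: "f \<in> Arr C" "Cod C f = A" "g \<in> Arr C" "Cod C g = Z" "Dom C f = Dom C g"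
      using A ZO by auto
    then show ?case
      using A ZO by (intro ex1I[of _ f]) (auto simp: Hom_iff intro: into_Z)
  qed (use A ZO in auto)
  have pbB: "is_pullback C (zm B Z) (Id C B) (Id C Z) (zm B Z)"
    unfolding is_pullback_def commutative_square_def
  proof (intro conjI allI impI, goal_cases)
    case (10 f g)
    then have f: "f \<in> Arr C" "Cod C f = Z" "g \<in> Arr C" "Cod C g = B" "Dom C f = Dom C g"
      using B ZO by auto
    then show ?case
      using B ZO by (intro ex1I[of _ g]) (auto simp: Hom_iff intro: into_Z)
  qed (use B ZO in auto)
  let ?t = "cmap (Id C A) (zm B Z)" and ?l = "cmap (zm A Z) (Id C B)"
  have pb: "is_pullback C ?t ?l (cmap (zm A Z) (Id C Z)) (cmap (Id C Z) (zm B Z))"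
    using b pbA pbB unfolding condition_b_def by blast
  \<comment> \<open>Adding a zero object changes nothing: as \<open>inr A Z\<close> is a zero
    morphism, \<open>inl A Z\<close> is inverse to \<open>pr1 A Z\<close>; symmetrically for
    \<open>Z + B\<close>.\<close>
  have "inr A Z = zm Z (Cod C (inl A Z))"
    by (rule from_Z) (use A ZO in \<open>auto simp: Hom_iff\<close>)
  then have eA: "inl A Z \<bullet> pr1 A Z = Id C (Cod C (inl A Z))"
    by (rule_tac coprod_eqI[of _ _ A Z]; use A ZO in simp)
  have "inl Z B = zm Z (Cod C (inl Z B))"
    by (rule from_Z) (use B ZO in \<open>auto simp: Hom_iff\<close>)
  then have eB: "inr Z B \<bullet> pr2 Z B = Id C (Cod C (inl Z B))"
    by (rule_tac coprod_eqI[of _ _ Z B]; use B ZO in simp)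
  \<comment> \<open>Along the isomorphisms of \<open>A + Z\<close> with \<open>A\<close> and of
    \<open>Z + B\<close> with \<open>B\<close>, the two sides of the pullback become
    \<open>pr1 A B\<close> and \<open>pr2 A B\<close>.\<close>
  have tu: "?t \<bullet> u = inl A Z \<bullet> (pr1 A B \<bullet> u)" "?l \<bullet> u = inr Z B \<bullet> (pr2 A B \<bullet> u)"
    if u: "u \<in> Arr C" "Cod C u = Cod C (inl A B)" for u
  proof -
    have "?t \<bullet> u = (inl A Z \<bullet> pr1 A Z) \<bullet> (?t \<bullet> u)"
      using eA A B ZO u by simp
    also have "\<dots> = inl A Z \<bullet> (pr1 A B \<bullet> u)"
      using A B ZO u by simp
    finally show "?t \<bullet> u = inl A Z \<bullet> (pr1 A B \<bullet> u)" .
    have "?l \<bullet> u = (inr Z B \<bullet> pr2 Z B) \<bullet> (?l \<bullet> u)"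
      using eB A B ZO u by simp
    also have "\<dots> = inr Z B \<bullet> (pr2 A B \<bullet> u)"
      using A B ZO u by simp
    finally show "?l \<bullet> u = inr Z B \<bullet> (pr2 A B \<bullet> u)" .
  qed
  have cancel: "inl A Z \<bullet> f = inl A Z \<bullet> f' \<longleftrightarrow> f = f'"
    if "f \<in> Arr C" "f' \<in> Arr C" "Cod C f = A" "Cod C f' = A" for f f'
    using that A ZO pr_inj_assoc(1)[of A Z f] pr_inj_assoc(1)[of A Z f'] by metis
  have cancel': "inr Z B \<bullet> f = inr Z B \<bullet> f' \<longleftrightarrow> f = f'"
    if "f \<in> Arr C" "f' \<in> Arr C" "Cod C f = B" "Cod C f' = B" for f f'
    using that B ZO pr_inj_assoc(4)[of Z B f] pr_inj_assoc(4)[of Z B f'] by metis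
  show ?thesis
    unfolding is_product_def
  proof (intro conjI allI ballI)
    fix X f g assume "f \<in> Hom C X A" "g \<in> Hom C X B"
    then have fg: "f \<in> Arr C" "g \<in> Arr C" "Cod C f = A" "Cod C g = B" "Dom C f = X" "Dom C g = X"
      by (auto simp: Hom_iff)
    then have X: "X \<in> Obj C" by auto
    \<comment> \<open>Both composites are zero morphisms, so every pair \<open>f\<close>,
      \<open>g\<close> gives a commutative square and the pullback property becomes a product
      property.\<close>
    have "commutative_square C (inl A Z \<bullet> f) (inr Z B \<bullet> g) (cmap (zm A Z) (Id C Z)) (cmap (Id C Z) (zm B Z))"
      using fg A B X ZO by (simp add: commutative_square_def)
    from pullback_ex1[OF pb this]
    have "\<exists>!u. u \<in> Hom C X (Cod C (inl A B)) \<and> ?t \<bullet> u = inl A Z \<bullet> f \<and> ?l \<bullet> u = inr Z B \<bullet> g"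
      using fg A B ZO by simp
    moreover have "?t \<bullet> u = inl A Z \<bullet> f \<and> ?l \<bullet> u = inr Z B \<bullet> g \<longleftrightarrow> pr1 A B \<bullet> u = f \<and> pr2 A B \<bullet> u = g"
      if "u \<in> Hom C X (Cod C (inl A B))" for u
      using that fg A B X ZO by (auto simp: tu cancel cancel' Hom_iff)
    ultimately show "\<exists>!u. u \<in> Hom C X (Cod C (inl A B)) \<and> pr1 A B \<bullet> u = f \<and> pr2 A B \<bullet> u = g"
      by (metis (no_types, lifting))
  qed (use A B in \<open>auto simp: Hom_iff\<close>)
qed

end

section \<open>Enrichment in commutative monoids\<close>

locale cmon_category = zero_category C zm for C :: "('o, 'm) cat" (structure) and zm +
  fixes add :: "'m \<Rightarrow> 'm \<Rightarrow> 'm"  (infixl "\<boxplus>" 65)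
  assumes add_simps [simp]:
      "f \<in> Arr C \<Longrightarrow> g \<in> Arr C \<Longrightarrow> Dom C f = Dom C g \<Longrightarrow> Cod C f = Cod C g \<Longrightarrow> f \<boxplus> g \<in> Arr C"
      "f \<in> Arr C \<Longrightarrow> g \<in> Arr C \<Longrightarrow> Dom C f = Dom C g \<Longrightarrow> Cod C f = Cod C g \<Longrightarrow> Dom C (f \<boxplus> g) = Dom C g"
      "f \<in> Arr C \<Longrightarrow> g \<in> Arr C \<Longrightarrow> Dom C f = Dom C g \<Longrightarrow> Cod C f = Cod C g \<Longrightarrow> Cod C (f \<boxplus> g) = Cod C g"
    and add_assoc: "f \<in> Arr C \<Longrightarrow> g \<in> Arr C \<Longrightarrow> h \<in> Arr C \<Longrightarrow> Dom C f = Dom C g \<Longrightarrow> Cod C f = Cod C g \<Longrightarrow>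
      Dom C g = Dom C h \<Longrightarrow> Cod C g = Cod C h \<Longrightarrow> (f \<boxplus> g) \<boxplus> h = f \<boxplus> (g \<boxplus> h)"
    and add_commute: "f \<in> Arr C \<Longrightarrow> g \<in> Arr C \<Longrightarrow> Dom C f = Dom C g \<Longrightarrow> Cod C f = Cod C g \<Longrightarrow> f \<boxplus> g = g \<boxplus> f"
    and add_zm [simp]: "f \<in> Arr C \<Longrightarrow> Dom C f = A \<Longrightarrow> Cod C f = B \<Longrightarrow> f \<boxplus> zm A B = f"
    and add_comp [simp]: "f \<in> Arr C \<Longrightarrow> g \<in> Arr C \<Longrightarrow> h \<in> Arr C \<Longrightarrow> Dom C f = Dom C g \<Longrightarrow> Cod C f = Cod C g \<Longrightarrow>
      Cod C h = Dom C g \<Longrightarrow> (f \<boxplus> g) \<bullet> h = f \<bullet> h \<boxplus> g \<bullet> h"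
    and comp_add [simp]: "f \<in> Arr C \<Longrightarrow> g \<in> Arr C \<Longrightarrow> h \<in> Arr C \<Longrightarrow> Dom C f = Dom C g \<Longrightarrow> Cod C f = Cod C g \<Longrightarrow>
      Cod C g = Dom C h \<Longrightarrow> h \<bullet> (f \<boxplus> g) = h \<bullet> f \<boxplus> h \<bullet> g"
begin

lemma zm_add [simp]: "f \<in> Arr C \<Longrightarrow> Dom C f = A \<Longrightarrow> Cod C f = B \<Longrightarrow> zm A B \<boxplus> f = f"
  using add_commute[of "zm A B" f] by auto

text \<open>With i = (1, 0) and j = (0, 1), comparing coordinates gives ip + jq = 1. Hence u = (ui)p
  + (uj)q for every u out of \<open>P\<close>, which dictates the copairing fp + gq and its
  uniqueness.\<close>

lemma coproduct_of_product:
  assumes prod: "is_product C A B P p q" and A: "A \<in> Obj C" and B: "B \<in> Obj C"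
  shows "\<exists>i j. is_coproduct C A B P i j"
proof -
  have pq [simp]: "p \<in> Arr C" "Dom C p = P" "Cod C p = A" "q \<in> Arr C" "Dom C q = P" "Cod C q = B"
    using prod by (auto simp: is_product_def Hom_iff)
  have P [simp]: "P \<in> Obj C" using Dom_in_Obj[OF pq(1)] by simp
  note [simp] = A B
  have ex: "\<exists>u. u \<in> Hom C X P \<and> p \<bullet> u = f \<and> q \<bullet> u = g" if "f \<in> Hom C X A" "g \<in> Hom C X B" for X f g
    using prod that unfolding is_product_def by blast
  have ext: "u = v" if "u \<in> Hom C X P" "v \<in> Hom C X P" "p \<bullet> u = p \<bullet> v" "q \<bullet> u = q \<bullet> v" for X u v
  proof -
    have "p \<bullet> v \<in> Hom C X A" "q \<bullet> v \<in> Hom C X B"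
      using that by (auto simp: Hom_iff)
    then have "\<exists>!w. w \<in> Hom C X P \<and> p \<bullet> w = p \<bullet> v \<and> q \<bullet> w = q \<bullet> v"
      using prod unfolding is_product_def by blast
    then show ?thesis using that by metis
  qed
  obtain i where i: "i \<in> Hom C A P" "p \<bullet> i = Id C A" "q \<bullet> i = zm A B"
    using ex[of "Id C A" A "zm A B"] by (auto simp: Hom_iff)
  obtain j where j: "j \<in> Hom C B P" "p \<bullet> j = zm B A" "q \<bullet> j = Id C B"
    using ex[of "zm B A" B "Id C B"] by (auto simp: Hom_iff)
  have [simp]: "i \<in> Arr C" "Dom C i = A" "Cod C i = P" "j \<in> Arr C" "Dom C j = B" "Cod C j = P"
    using i j by (auto simp: Hom_iff)
  have id: "i \<bullet> p \<boxplus> j \<bullet> q = Id C P"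
    by (rule ext[of _ P]) (simp_all add: Hom_iff i j Comp_assoc_Arr[symmetric] del: Comp_assoc_Arr)
  have "is_coproduct C A B P i j"
    unfolding is_coproduct_def
  proof (intro conjI allI ballI)
    fix X f g assume "f \<in> Hom C A X" "g \<in> Hom C B X"
    then have fg [simp]: "f \<in> Arr C" "g \<in> Arr C" "Dom C f = A" "Dom C g = B" "Cod C f = X" "Cod C g = X"
      by (auto simp: Hom_iff)
    have [simp]: "X \<in> Obj C" using Cod_in_Obj[OF fg(1)] by simp
    show "\<exists>!u. u \<in> Hom C P X \<and> u \<bullet> i = f \<and> u \<bullet> j = g"
    proof (rule ex1I[of _ "f \<bullet> p \<boxplus> g \<bullet> q"])
      show "f \<bullet> p \<boxplus> g \<bullet> q \<in> Hom C P X \<and> (f \<bullet> p \<boxplus> g \<bullet> q) \<bullet> i = f \<and> (f \<bullet> p \<boxplus> g \<bullet> q) \<bullet> j = g"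
        by (simp add: Hom_iff i j)
      fix u assume u: "u \<in> Hom C P X \<and> u \<bullet> i = f \<and> u \<bullet> j = g"
      then have [simp]: "u \<in> Arr C" "Dom C u = P" "Cod C u = X" by (auto simp: Hom_iff)
      have "u = u \<bullet> (i \<bullet> p \<boxplus> j \<bullet> q)" by (simp add: id)
      also have "\<dots> = (u \<bullet> i) \<bullet> p \<boxplus> (u \<bullet> j) \<bullet> q" by simp
      finally show "u = f \<bullet> p \<boxplus> g \<bullet> q" using u by simp
    qed
  qed (auto simp: Hom_iff)
  then show ?thesis by blast
qed

end

section \<open>Biproducts and the addition that they induce\<close>

locale biproduct_category = zero_coproduct_category C zm inl inr
  for C :: "('o, 'm) cat" (structure) and zm inl inr +
  assumes biproduct: "A \<in> Obj C \<Longrightarrow> B \<in> Obj C \<Longrightarrow> is_product C A B (Cod C (inl A B)) (pr1 A B) (pr2 A B)"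
begin

definition pair :: "'m \<Rightarrow> 'm \<Rightarrow> 'm" where
  "pair f g = (THE u. u \<in> Hom C (Dom C f) (Cod C (inl (Cod C f) (Cod C g))) \<and>
    pr1 (Cod C f) (Cod C g) \<bullet> u = f \<and> pr2 (Cod C f) (Cod C g) \<bullet> u = g)"

lemma pair_THE:
  assumes "f \<in> Arr C" "g \<in> Arr C" "Dom C f = Dom C g"
  shows "\<exists>!u. u \<in> Hom C (Dom C f) (Cod C (inl (Cod C f) (Cod C g))) \<and>
    pr1 (Cod C f) (Cod C g) \<bullet> u = f \<and> pr2 (Cod C f) (Cod C g) \<bullet> u = g"
  using biproduct[of "Cod C f" "Cod C g"] assms by (simp add: is_product_def Hom_iff)

lemma pair_simps [simp]:
  assumes "f \<in> Arr C" "g \<in> Arr C" "Dom C f = Dom C g"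
  shows "pair f g \<in> Arr C" "Dom C (pair f g) = Dom C g" "Cod C (pair f g) = Cod C (inl (Cod C f) (Cod C g))"
  using theI'[OF pair_THE[OF assms]] assms(3) unfolding pair_def Hom_iff by simp_all

lemma pr_pair [simp]:
  assumes "f \<in> Arr C" "g \<in> Arr C" "Dom C f = Dom C g" "Cod C f = A" "Cod C g = B"
  shows "pr1 A B \<bullet> pair f g = f" "pr2 A B \<bullet> pair f g = g"
  using theI'[OF pair_THE[OF assms(1-3)]] unfolding pair_def assms(4,5) by simp_all

lemma pr_pair_assoc [simp]:
  assumes "f \<in> Arr C" "g \<in> Arr C" "Dom C f = Dom C g" "Cod C f = A" "Cod C g = B" "h \<in> Arr C" "Cod C h = Dom C g"
  shows "pr1 A B \<bullet> (pair f g \<bullet> h) = f \<bullet> h" "pr2 A B \<bullet> (pair f g \<bullet> h) = g \<bullet> h"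
  using assms by (auto intro!: Comp_eq_assoc)

lemma prod_eqI:
  assumes "u \<in> Arr C" "v \<in> Arr C" "Cod C u = Cod C (inl A B)" "Cod C v = Cod C (inl A B)"
    "A \<in> Obj C" "B \<in> Obj C" "pr1 A B \<bullet> u = pr1 A B \<bullet> v" "pr2 A B \<bullet> u = pr2 A B \<bullet> v"
  shows "u = v"
proof -
  have "Dom C (pr1 A B \<bullet> u) = Dom C (pr1 A B \<bullet> v)"
    using assms(7) by simp
  then have dom: "Dom C v = Dom C u"
    using assms(1-6) by simp
  have "pr1 A B \<bullet> u \<in> Hom C (Dom C u) A" "pr2 A B \<bullet> u \<in> Hom C (Dom C u) B"
    using assms(1-6) by (auto simp: Hom_iff)
  then have "\<exists>!w. w \<in> Hom C (Dom C u) (Cod C (inl A B)) \<and> pr1 A B \<bullet> w = pr1 A B \<bullet> u \<and> pr2 A B \<bullet> w = pr2 A B \<bullet> u"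
    using biproduct[OF assms(5,6)] unfolding is_product_def by blast
  moreover have "u \<in> Hom C (Dom C u) (Cod C (inl A B))" "v \<in> Hom C (Dom C u) (Cod C (inl A B))"
    using assms(1-4) dom by (auto simp: Hom_iff)
  ultimately show ?thesis
    using assms(7,8) by metis
qed

definition codiag :: "'o \<Rightarrow> 'm" where "codiag B = cp (Id C B) (Id C B)"

text \<open>The usual sum in a category with biproducts: the pairing into B \<times> B, read as B +
  B, followed by the fold map.\<close>

definition plus :: "'m \<Rightarrow> 'm \<Rightarrow> 'm"  (infixl "\<boxplus>" 65) where
  "f \<boxplus> g = codiag (Cod C g) \<bullet> pair f g"

lemma codiag_simps [simp]:
  assumes "B \<in> Obj C"
  shows "codiag B \<in> Arr C" "Dom C (codiag B) = Cod C (inl B B)" "Cod C (codiag B) = B"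
  using assms by (simp_all add: codiag_def)

lemma plus_simps [simp]:
  assumes "f \<in> Arr C" "g \<in> Arr C" "Dom C f = Dom C g" "Cod C f = Cod C g"
  shows "f \<boxplus> g \<in> Arr C" "Dom C (f \<boxplus> g) = Dom C g" "Cod C (f \<boxplus> g) = Cod C g"
  using assms by (simp_all add: plus_def)

lemma plus_comp:
  assumes "f \<in> Arr C" "g \<in> Arr C" "h \<in> Arr C" "Dom C f = Dom C g" "Cod C f = Cod C g" "Cod C h = Dom C g"
  shows "(f \<boxplus> g) \<bullet> h = f \<bullet> h \<boxplus> g \<bullet> h"
proof -
  have "pair f g \<bullet> h = pair (f \<bullet> h) (g \<bullet> h)"
    by (rule prod_eqI[of _ _ "Cod C g" "Cod C g"]) (use assms in simp_all)
  then show ?thesis using assms by (simp add: plus_def)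
qed

text \<open>Precomposition only concerns the pairing, whereas postcomposition has to pass the fold
  map; this is the naturality of the fold map, and \<open>cmap h h\<close> then acts on the pair
  coordinatewise.\<close>

lemma comp_plus:
  assumes "f \<in> Arr C" "g \<in> Arr C" "h \<in> Arr C" "Dom C f = Dom C g" "Cod C f = Cod C g" "Cod C g = Dom C h"
  shows "h \<bullet> (f \<boxplus> g) = h \<bullet> f \<boxplus> h \<bullet> g"
proof -
  have "h \<bullet> codiag (Dom C h) = codiag (Cod C h) \<bullet> cmap h h"
    by (rule coprod_eqI[of _ _ "Dom C h" "Dom C h"]) (use assms in \<open>simp_all add: codiag_def\<close>)
  then have "h \<bullet> (codiag (Dom C h) \<bullet> pair f g) = (codiag (Cod C h) \<bullet> cmap h h) \<bullet> pair f g"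
    using assms by (intro Comp_eq_assoc) simp_all
  moreover have "cmap h h \<bullet> pair f g = pair (h \<bullet> f) (h \<bullet> g)"
    by (rule prod_eqI[of _ _ "Cod C h" "Cod C h"]) (use assms in simp_all)
  ultimately show ?thesis using assms by (simp add: plus_def)
qed

lemma plus_zm:
  assumes "f \<in> Arr C" "Dom C f = A" "Cod C f = B"
  shows "f \<boxplus> zm A B = f" "zm A B \<boxplus> f = f"
proof -
  have AB: "A \<in> Obj C" "B \<in> Obj C" using assms by auto
  have "pair f (zm A B) = inl B B \<bullet> f"
    by (rule prod_eqI[of _ _ B B]) (use assms AB in simp_all)
  then show "f \<boxplus> zm A B = f" using assms AB by (simp add: plus_def codiag_def)
  have "pair (zm A B) f = inr B B \<bullet> f"
    by (rule prod_eqI[of _ _ B B]) (use assms AB in simp_all)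
  then show "zm A B \<boxplus> f = f" using assms AB by (simp add: plus_def codiag_def)
qed

lemma plus_interchange:
  assumes "a \<in> Hom C A B" "b \<in> Hom C A B" "c \<in> Hom C A B" "d \<in> Hom C A B"
  shows "(a \<boxplus> b) \<boxplus> (c \<boxplus> d) = (a \<boxplus> c) \<boxplus> (b \<boxplus> d)"
proof -
  have [simp]: "x \<in> Arr C" "Dom C x = A" "Cod C x = B" if "x \<in> {a, b, c, d}" for x
    using assms that by (auto simp: Hom_iff)
  have AB: "A \<in> Obj C" "B \<in> Obj C" using Dom_in_Obj[of a] Cod_in_Obj[of a] by simp_all
  have "pair (a \<boxplus> b) (c \<boxplus> d) = pair a c \<boxplus> pair b d"
    by (rule prod_eqI[of _ _ B B]) (use AB in \<open>simp_all add: comp_plus\<close>)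
  \<comment> \<open>Only the outer sum on the left and the two inner sums on the right are unfolded;
    what remains is that postcomposition with the fold map preserves the sum of
    \<open>pair a c\<close> and \<open>pair b d\<close>.\<close>
  then show ?thesis
    using AB comp_plus[of "pair a c" "pair b d" "codiag B"] by (simp add: plus_def[of _ "c \<boxplus> d"] plus_def[of a c] plus_def[of b d])
qed

text \<open>Associativity and commutativity follow from the interchange law by the Eckmann-Hilton argument.\<close>

lemma cmon_plus: "cmon_category C zm (\<boxplus>)"
proof unfold_locales
  fix f g h
  assume fgh: "f \<in> Arr C" "g \<in> Arr C" "h \<in> Arr C" "Dom C f = Dom C g" "Cod C f = Cod C g"
    "Dom C g = Dom C h" "Cod C g = Cod C h"
  then show "(f \<boxplus> g) \<boxplus> h = f \<boxplus> (g \<boxplus> h)"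
    \<comment> \<open>The instance is (f + g) + (0 + h) = (f + 0) + (g + h); for commutativity below
      it is (0 + f) + (g + 0) = (0 + g) + (f + 0).\<close>
    using plus_interchange[of f "Dom C h" "Cod C h" g "zm (Dom C h) (Cod C h)" h]
    by (simp add: Hom_iff plus_zm)
next
  fix f g
  assume "f \<in> Arr C" "g \<in> Arr C" "Dom C f = Dom C g" "Cod C f = Cod C g"
  then show "f \<boxplus> g = g \<boxplus> f"
    using plus_interchange[of "zm (Dom C g) (Cod C g)" "Dom C g" "Cod C g" f g "zm (Dom C g) (Cod C g)"]
    by (simp add: Hom_iff plus_zm)
qed (auto simp: plus_zm plus_comp comp_plus)

end

text \<open>The common ground of both directions. An addition makes every chosen coproduct a
  biproduct through \<open>inj_pr\<close>, so arrows into it may be compared by coordinates.\<close>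

locale cmon_coproduct_category = cmon_category C zm add + zero_coproduct_category C zm inl inr
  for C :: "('o, 'm) cat" (structure) and zm and add (infixl "\<boxplus>" 65) and inl inr
begin

lemma inj_pr:
  assumes "A \<in> Obj C" "B \<in> Obj C"
  shows "inl A B \<bullet> pr1 A B \<boxplus> inr A B \<bullet> pr2 A B = Id C (Cod C (inl A B))"
  by (rule coprod_eqI[of _ _ A B]) (use assms in simp_all)

lemma inj_pr_comp:
  assumes "A \<in> Obj C" "B \<in> Obj C" "u \<in> Arr C" "Cod C u = Cod C (inl A B)"
  shows "inl A B \<bullet> (pr1 A B \<bullet> u) \<boxplus> inr A B \<bullet> (pr2 A B \<bullet> u) = u"
  using arg_cong[OF inj_pr[OF assms(1,2)], of "\<lambda>w. w \<bullet> u"] assms by simp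

lemma copair_comp:
  assumes "f \<in> Arr C" "g \<in> Arr C" "Cod C f = Cod C g" "u \<in> Arr C" "Cod C u = Cod C (inl (Dom C f) (Dom C g))"
  shows "cp f g \<bullet> u = f \<bullet> (pr1 (Dom C f) (Dom C g) \<bullet> u) \<boxplus> g \<bullet> (pr2 (Dom C f) (Dom C g) \<bullet> u)"
  using arg_cong[OF inj_pr_comp[of "Dom C f" "Dom C g" u], of "\<lambda>w. cp f g \<bullet> w"] assms by simp

lemma biprod_eqI:
  assumes "u \<in> Arr C" "v \<in> Arr C" "Cod C u = Cod C (inl A B)" "Cod C v = Cod C (inl A B)"
    "A \<in> Obj C" "B \<in> Obj C" "pr1 A B \<bullet> u = pr1 A B \<bullet> v" "pr2 A B \<bullet> u = pr2 A B \<bullet> v"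
  shows "u = v"
  using inj_pr_comp[OF assms(5,6,1,3)] inj_pr_comp[OF assms(5,6,2,4)] unfolding assms(7,8) by (rule subst)

lemma codiag_comp:
  assumes "A \<in> Obj C" "u \<in> Arr C" "Cod C u = Cod C (inl A A)"
  shows "cp (Id C A) (Id C A) \<bullet> u = pr1 A A \<bullet> u \<boxplus> pr2 A A \<bullet> u"
  using assms copair_comp[of "Id C A" "Id C A" u] by simp

end


section \<open>Condition P yields negatives\<close>

context cmon_coproduct_category
begin

text \<open>The equation says that (f, g) into \<open>A + S\<close> and \<open>h\<close> into
  \<open>S\<close> agree in \<open>A\<close>. They therefore factor through the pullback
  \<open>S + S\<close>, and the first coordinate of the factorization lifts \<open>f\<close> along
  \<open>m\<close>.\<close>

lemma subtractive_if_condition_c: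
  assumes c: "condition_c C inl inr" and m: "is_mono C m" "m \<in> Hom C S A"
    and f: "f \<in> Hom C X A" and g: "g \<in> Hom C X S" and h: "h \<in> Hom C X S"
    and eq: "f \<boxplus> m \<bullet> g = m \<bullet> h"
  shows "\<exists>u \<in> Hom C X S. m \<bullet> u = f"
proof -
  have [simp]: "m \<in> Arr C" "Dom C m = S" "Cod C m = A" "f \<in> Arr C" "Dom C f = X" "Cod C f = A"
      "g \<in> Arr C" "Dom C g = X" "Cod C g = S" "h \<in> Arr C" "Dom C h = X" "Cod C h = S"
    using m f g h by (auto simp: Hom_iff)
  have [simp]: "A \<in> Obj C" "S \<in> Obj C" "X \<in> Obj C"
    using Dom_in_Obj[of m] Cod_in_Obj[of m] Dom_in_Obj[of f] by simp_all
  let ?F = "inl A S \<bullet> f \<boxplus> inr A S \<bullet> g"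
  have "is_pullback C (cmap m (Id C S)) (cp (Id C S) (Id C S)) (cp (Id C A) m) m"
    using c m unfolding condition_c_def by blast
  moreover have "commutative_square C ?F h (cp (Id C A) m) m"
    by (simp add: commutative_square_def eq)
  ultimately have "\<exists>!u. u \<in> Hom C (Dom C ?F) (Dom C (cmap m (Id C S))) \<and>
      cmap m (Id C S) \<bullet> u = ?F \<and> cp (Id C S) (Id C S) \<bullet> u = h"
    by (rule pullback_ex1)
  then obtain u where u: "u \<in> Hom C X (Cod C (inl S S))" "cmap m (Id C S) \<bullet> u = ?F"
    by auto
  then have [simp]: "u \<in> Arr C" "Dom C u = X" "Cod C u = Cod C (inl S S)"
    by (auto simp: Hom_iff)
  have "m \<bullet> (pr1 S S \<bullet> u) = pr1 A S \<bullet> (cmap m (Id C S) \<bullet> u)" by simp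
  also have "\<dots> = f" unfolding u(2) by simp
  finally show ?thesis by (intro bexI[of _ "pr1 S S \<bullet> u"]) (auto simp: Hom_iff)
qed

text \<open>Apply subtractivity to the diagonal: from \<open>(f, g) + (h, h) = (k, k)\<close> it follows that \<open>(f, g)\<close>
  lies on the diagonal.\<close>

lemma cancellation_if_condition_c:
  assumes c: "condition_c C inl inr" and f: "f \<in> Hom C X B" and g: "g \<in> Hom C X B" and h: "h \<in> Hom C X B"
    and eq: "f \<boxplus> h = g \<boxplus> h"
  shows "f = g"
proof -
  have [simp]: "f \<in> Arr C" "Dom C f = X" "Cod C f = B" "g \<in> Arr C" "Dom C g = X" "Cod C g = B"
      "h \<in> Arr C" "Dom C h = X" "Cod C h = B"
    using f g h by (auto simp: Hom_iff)
  have [simp]: "B \<in> Obj C" "X \<in> Obj C"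
    using Dom_in_Obj[of f] Cod_in_Obj[of f] by simp_all
  \<comment> \<open>This is the diagonal; \<open>pm\<close> shows that both projections split
    it.\<close>
  let ?m = "inl B B \<boxplus> inr B B"
  have pm: "pr1 B B \<bullet> (?m \<bullet> u) = u" "pr2 B B \<bullet> (?m \<bullet> u) = u" if "u \<in> Arr C" "Cod C u = B" for u
    using that by simp_all
  have mono: "is_mono C ?m"
    unfolding is_mono_def
  proof (intro conjI allI ballI impI)
    fix Y u v assume "u \<in> Hom C Y (Dom C ?m)" "v \<in> Hom C Y (Dom C ?m)" and eq: "?m \<bullet> u = ?m \<bullet> v"
    then have "u \<in> Arr C" "Cod C u = B" "v \<in> Arr C" "Cod C v = B" by (auto simp: Hom_iff)
    then show "u = v" using pm(1)[of u] pm(1)[of v] unfolding eq by metis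
  qed simp
  have "\<exists>u \<in> Hom C X B. ?m \<bullet> u = inl B B \<bullet> f \<boxplus> inr B B \<bullet> g"
  proof (rule subtractive_if_condition_c[OF c mono])
    show "inl B B \<bullet> f \<boxplus> inr B B \<bullet> g \<boxplus> ?m \<bullet> h = ?m \<bullet> (g \<boxplus> h)"
      by (rule biprod_eqI[of _ _ B B]) (simp_all add: eq)
  qed (simp_all add: Hom_iff)
  then obtain u where "u \<in> Arr C" "Dom C u = X" "Cod C u = B" and u: "?m \<bullet> u = inl B B \<bullet> f \<boxplus> inr B B \<bullet> g"
    by (auto simp: Hom_iff)
  then show "f = g"
    using pm[of u] unfolding u by simp
qed

text \<open>By cancellation \<open>m(x, y) = (x, x + y)\<close> is a monomorphism. Since
  \<open>(1, 0) + m(0, 1) = (1, 1) = m(1, 0)\<close>, subtractivity gives \<open>(1, 0) = m(x, y)\<close> for some \<open>x, y\<close>,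
  that is, \<open>1 + y = 0\<close>.\<close>

lemma negative_if_condition_c:
  assumes c: "condition_c C inl inr" and B: "B \<in> Obj C"
  shows "\<exists>v \<in> Hom C B B. Id C B \<boxplus> v = zm B B"
proof -
  note [simp] = B
  let ?K = "Cod C (inl B B)"
  have [simp]: "?K \<in> Obj C" by simp
  let ?m = "inl B B \<bullet> pr1 B B \<boxplus> inr B B \<bullet> (pr1 B B \<boxplus> pr2 B B)"
  have pm: "pr1 B B \<bullet> (?m \<bullet> u) = pr1 B B \<bullet> u" "pr2 B B \<bullet> (?m \<bullet> u) = pr1 B B \<bullet> u \<boxplus> pr2 B B \<bullet> u"
    if "u \<in> Arr C" "Cod C u = ?K" for u
    using that by simp_all
  have mono: "is_mono C ?m"
    unfolding is_mono_def
  proof (intro conjI allI ballI impI)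
    fix Y u v assume "u \<in> Hom C Y (Dom C ?m)" "v \<in> Hom C Y (Dom C ?m)" and eq: "?m \<bullet> u = ?m \<bullet> v"
    then have [simp]: "u \<in> Arr C" "Dom C u = Y" "Cod C u = ?K" "v \<in> Arr C" "Dom C v = Y" "Cod C v = ?K"
      by (auto simp: Hom_iff)
    have 1: "pr1 B B \<bullet> u = pr1 B B \<bullet> v"
      using pm(1)[of u] pm(1)[of v] unfolding eq by simp
    have "pr1 B B \<bullet> u \<boxplus> pr2 B B \<bullet> u = pr1 B B \<bullet> v \<boxplus> pr2 B B \<bullet> v"
      using pm(2)[of u] pm(2)[of v] unfolding eq by simp
    \<comment> \<open>The common summand is moved to the right, where cancellation expects
      it.\<close>
    then have "pr2 B B \<bullet> u \<boxplus> pr1 B B \<bullet> v = pr2 B B \<bullet> v \<boxplus> pr1 B B \<bullet> v"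
      by (simp add: 1 add_commute[of "pr1 B B \<bullet> v"])
    then have "pr2 B B \<bullet> u = pr2 B B \<bullet> v"
      by (rule cancellation_if_condition_c[OF c, of _ Y B _ "pr1 B B \<bullet> v", rotated -1]) (simp_all add: Hom_iff)
    with 1 show "u = v"
      by (intro biprod_eqI[of u v B B]) simp_all
  qed simp
  have "\<exists>u \<in> Hom C B ?K. ?m \<bullet> u = inl B B"
  proof (rule subtractive_if_condition_c[OF c mono])
    show "inl B B \<boxplus> ?m \<bullet> inr B B = ?m \<bullet> inl B B"
      by simp
  qed (simp_all add: Hom_iff)
  then obtain u where u: "u \<in> Arr C" "Dom C u = B" "Cod C u = ?K" "?m \<bullet> u = inl B B"
    by (auto simp: Hom_iff)
  have "pr1 B B \<bullet> u = Id C B" "pr1 B B \<bullet> u \<boxplus> pr2 B B \<bullet> u = zm B B"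
    using pm[OF u(1,3)] unfolding u(4) by simp_all
  then show ?thesis
    using u by (intro bexI[of _ "pr2 B B \<bullet> u"]) (auto simp: Hom_iff)
qed

text \<open>Negatives of identities suffice: composing 1 + v = 0 with \<open>f\<close> makes
  \<open>v \<bullet> f\<close> a negative of \<open>f\<close>.\<close>

lemma additive_if_negatives:
  assumes "is_pointed C" "has_binary_products C"
    and neg: "\<And>B. B \<in> Obj C \<Longrightarrow> \<exists>v \<in> Hom C B B. Id C B \<boxplus> v = zm B B"
  shows "is_additive C"
proof -
  define G where "G A B = \<lparr>carrier = Hom C A B, mult = (\<boxplus>), one = zm A B\<rparr>" for A B
  have "comm_group (G A B)" if [simp]: "A \<in> Obj C" "B \<in> Obj C" for A B
  proof (rule comm_groupI)
    fix f assume "f \<in> carrier (G A B)"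
    then have [simp]: "f \<in> Arr C" "Dom C f = A" "Cod C f = B" by (auto simp: G_def Hom_iff)
    obtain v where v: "v \<in> Arr C" "Dom C v = B" "Cod C v = B" "Id C B \<boxplus> v = zm B B"
      using neg[of B] by (auto simp: Hom_iff)
    have "f \<boxplus> v \<bullet> f = (Id C B \<boxplus> v) \<bullet> f"
      using v(1-3) by simp
    also have "\<dots> = zm A B" unfolding v(4) by simp
    finally have "v \<bullet> f \<boxplus> f = zm A B"
      using v(1-3) add_commute[of f "v \<bullet> f"] by simp
    then show "\<exists>g\<in>carrier (G A B). g \<otimes>\<^bsub>G A B\<^esub> f = \<one>\<^bsub>G A B\<^esub>"
      using v by (intro bexI[of _ "v \<bullet> f"]) (auto simp: G_def Hom_iff)
  qed (auto simp: G_def Hom_iff add_assoc intro: add_commute)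
  moreover have "carrier (G A B) = Hom C A B" "mult (G A B) = (\<boxplus>)" for A B
    by (simp_all add: G_def)
  ultimately show ?thesis
    using assms(1,2) unfolding is_additive_def by (intro conjI exI[of _ G]) (auto simp: Hom_iff)
qed

end

lemma (in category) additive_if_condition_P:
  assumes "is_pointed C" and P: "condition_P C"
  shows "is_additive C"
proof -
  obtain Z where Z: "is_zero_object C Z"
    using assms(1) by (auto simp: is_pointed_def)
  then obtain zm where "zero_category C zm"
    using zero_morphisms_exist by blast
  then interpret zero_category C zm .
  \<comment> \<open>Clause (a) supplies a choice of coproducts to which the universally quantified
    clauses can be applied.\<close>
  obtain inl inr where ch: "coproduct_choice C inl inr"
    using coproduct_choice_exists binary_coproduct_of_finite_coproducts P unfolding condition_P_def by blast
  then have b: "condition_b C inl inr" and c: "condition_c C inl inr"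
    using P by (auto simp: condition_P_def)
  interpret zero_coproduct_category C zm inl inr
    by unfold_locales (rule ch)
  interpret biproduct_category C zm inl inr
    by unfold_locales (rule is_product_if_condition_b[OF Z b])
  interpret cmon_category C zm plus
    by (rule cmon_plus)
  interpret cmon_coproduct_category C zm plus inl inr ..
  have "has_binary_products C"
    using biproduct unfolding has_binary_products_def by blast
  then show ?thesis
    using assms(1) negative_if_condition_c[OF c] by (intro additive_if_negatives)
qed

section \<open>Additive categories satisfy Condition P\<close>

locale ab_category = cmon_category C zm add for C :: "('o, 'm) cat" (structure) and zm and add (infixl "\<boxplus>" 65) +
  fixes neg :: "'m \<Rightarrow> 'm"
  assumes neg_simps [simp]: "f \<in> Arr C \<Longrightarrow> neg f \<in> Arr C" "f \<in> Arr C \<Longrightarrow> Dom C (neg f) = Dom C f"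
      "f \<in> Arr C \<Longrightarrow> Cod C (neg f) = Cod C f"
    and add_neg [simp]: "f \<in> Arr C \<Longrightarrow> f \<boxplus> neg f = zm (Dom C f) (Cod C f)"
begin

lemma neg_add [simp]: "f \<in> Arr C \<Longrightarrow> neg f \<boxplus> f = zm (Dom C f) (Cod C f)"
  using add_commute[of f "neg f"] by simp

lemma add_add_neg [simp]:
  assumes "f \<in> Arr C" "g \<in> Arr C" "Dom C f = Dom C g" "Cod C f = Cod C g"
  shows "g \<boxplus> (f \<boxplus> neg g) = f" "f \<boxplus> g \<boxplus> neg g = f" "f \<boxplus> neg g \<boxplus> g = f" "g \<boxplus> f \<boxplus> neg g = f"
proof -
  show 1: "f \<boxplus> g \<boxplus> neg g = f" "f \<boxplus> neg g \<boxplus> g = f"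
    using assms by (simp_all add: add_assoc)
  have "g \<boxplus> f = f \<boxplus> g" "g \<boxplus> (f \<boxplus> neg g) = f \<boxplus> neg g \<boxplus> g"
    by (rule add_commute; use assms in simp)+
  then show "g \<boxplus> f \<boxplus> neg g = f" "g \<boxplus> (f \<boxplus> neg g) = f"
    using 1 by metis+
qed

lemma neg_unique:
  assumes "f \<in> Arr C" "g \<in> Arr C" "Dom C f = Dom C g" "Cod C f = Cod C g" "f \<boxplus> g = zm (Dom C g) (Cod C g)"
  shows "g = neg f"
proof -
  have "g = (f \<boxplus> g) \<boxplus> neg f" using assms(1-4) by simp
  also have "\<dots> = neg f" unfolding assms(5) using assms(1-4) by simp
  finally show ?thesis .
qed

lemma neg_zm [simp]: "A \<in> Obj C \<Longrightarrow> B \<in> Obj C \<Longrightarrow> neg (zm A B) = zm A B"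
  using neg_unique[of "zm A B" "zm A B"] by simp

lemma neg_add_add [simp]:
  assumes "f \<in> Arr C" "g \<in> Arr C" "Dom C f = Dom C g" "Cod C f = Cod C g"
  shows "neg f \<boxplus> (f \<boxplus> g) = g"
  using assms add_assoc[of "neg f" f g] by simp

lemma neg_comp [simp]:
  assumes "f \<in> Arr C" "h \<in> Arr C" "Cod C h = Dom C f"
  shows "neg f \<bullet> h = neg (f \<bullet> h)"
proof (rule neg_unique)
  have "f \<bullet> h \<boxplus> neg f \<bullet> h = (f \<boxplus> neg f) \<bullet> h"
    using assms by (simp del: add_neg)
  then show "f \<bullet> h \<boxplus> neg f \<bullet> h = zm (Dom C (neg f \<bullet> h)) (Cod C (neg f \<bullet> h))"
    using assms by simp
qed (use assms in simp_all)

lemma comp_neg [simp]: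
  assumes "f \<in> Arr C" "h \<in> Arr C" "Cod C f = Dom C h"
  shows "h \<bullet> neg f = neg (h \<bullet> f)"
proof (rule neg_unique)
  have "h \<bullet> f \<boxplus> h \<bullet> neg f = h \<bullet> (f \<boxplus> neg f)"
    using assms by (simp del: add_neg)
  then show "h \<bullet> f \<boxplus> h \<bullet> neg f = zm (Dom C (h \<bullet> neg f)) (Cod C (h \<bullet> neg f))"
    using assms by simp
qed (use assms in simp_all)

end

text \<open>The units of the hom-groups serve as zero morphisms. They absorb composition because
  bilinearity makes a composite with a unit idempotent, and a group has only one idempotent.\<close>

lemma (in category) ab_category_if_additive:
  assumes "is_additive C"
  shows "\<exists>zm add neg. ab_category C zm add neg"
proof -
  obtain G :: "'o \<Rightarrow> 'o \<Rightarrow> 'm monoid" where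
    G0: "\<forall>A\<in>Obj C. \<forall>B\<in>Obj C. comm_group (G A B) \<and> carrier (G A B) = Hom C A B"
    and distrib0: "\<forall>A\<in>Obj C. \<forall>B\<in>Obj C. \<forall>D\<in>Obj C.
        (\<forall>f \<in> Hom C A B. \<forall>g \<in> Hom C B D. \<forall>g' \<in> Hom C B D.
          (g \<otimes>\<^bsub>G B D\<^esub> g') \<bullet> f = (g \<bullet> f) \<otimes>\<^bsub>G A D\<^esub> (g' \<bullet> f)) \<and>
        (\<forall>f \<in> Hom C A B. \<forall>f' \<in> Hom C A B. \<forall>g \<in> Hom C B D.
          g \<bullet> (f \<otimes>\<^bsub>G A B\<^esub> f') = (g \<bullet> f) \<otimes>\<^bsub>G A D\<^esub> (g \<bullet> f'))"
    using assms unfolding is_additive_def by blast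
  have G: "comm_group (G A B)" "carrier (G A B) = Hom C A B" if "A \<in> Obj C" "B \<in> Obj C" for A B
    using G0 that by auto
  have distrib: "(g \<otimes>\<^bsub>G B D\<^esub> g') \<bullet> f = (g \<bullet> f) \<otimes>\<^bsub>G A D\<^esub> (g' \<bullet> f)"
    if "f \<in> Hom C A B" "g \<in> Hom C B D" "g' \<in> Hom C B D" for A B D f g g'
    using distrib0[THEN bspec, of A, THEN bspec, of B, THEN bspec, of D] that by (auto simp: Hom_iff)
  have distrib': "g \<bullet> (f \<otimes>\<^bsub>G A B\<^esub> f') = (g \<bullet> f) \<otimes>\<^bsub>G A D\<^esub> (g \<bullet> f')"
    if "f \<in> Hom C A B" "f' \<in> Hom C A B" "g \<in> Hom C B D" for A B D f f' g
    using distrib0[THEN bspec, of A, THEN bspec, of B, THEN bspec, of D] that by (auto simp: Hom_iff)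
  define zm where "zm A B = \<one>\<^bsub>G A B\<^esub>" for A B
  \<comment> \<open>The index of the group is read off the second summand; for parallel arrows the
    first would give the same.\<close>
  define add where "add f g = f \<otimes>\<^bsub>G (Dom C g) (Cod C g)\<^esub> g" for f g
  define neg where "neg f = inv\<^bsub>G (Dom C f) (Cod C f)\<^esub> f" for f
  have one: "zm A B \<in> Hom C A B" if "A \<in> Obj C" "B \<in> Obj C" for A B
    using comm_group.axioms(1)[OF G(1)[OF that]] G(2)[OF that] by (metis comm_monoid.axioms(1) monoid.one_closed zm_def)
  have idem: "x = zm A B" if "x \<in> Hom C A B" "x \<otimes>\<^bsub>G A B\<^esub> x = x" "A \<in> Obj C" "B \<in> Obj C" for x A B
    using comm_group.axioms(2)[OF G(1)] G(2) that group.l_cancel_one'[of "G A B" x x] by (simp add: zm_def)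
  have zz: "zm A B \<otimes>\<^bsub>G A B\<^esub> zm A B = zm A B" if "A \<in> Obj C" "B \<in> Obj C" for A B
  proof -
    interpret comm_group "G A B" using G(1) that .
    show ?thesis by (simp add: zm_def)
  qed
  have add: "add f g \<in> Hom C A B" "add f g = add g f" "add f (zm A B) = f" "neg f \<in> Hom C A B" "add f (neg f) = zm A B"
      "add (add f g) h = add f (add g h)"
    if "f \<in> Hom C A B" "g \<in> Hom C A B" "h \<in> Hom C A B" for f g h A B
  proof -
    have AB: "A \<in> Obj C" "B \<in> Obj C" using that by (auto simp: Hom_iff)
    interpret comm_group "G A B" using G(1) AB .
    have c: "carrier (G A B) = Hom C A B" using G(2) AB .
    have [simp]: "f \<in> carrier (G A B)" "g \<in> carrier (G A B)" "h \<in> carrier (G A B)" using that c by auto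
    have ad: "add x y = x \<otimes>\<^bsub>G A B\<^esub> y" if "y \<in> carrier (G A B)" for x y
      using that by (simp add: add_def c Hom_iff)
    have ng: "neg f = inv\<^bsub>G A B\<^esub> f"
      using that by (simp add: neg_def Hom_iff)
    show "add f g \<in> Hom C A B" "add f g = add g f" "add f (zm A B) = f" "neg f \<in> Hom C A B" "add f (neg f) = zm A B"
        "add (add f g) h = add f (add g h)"
      by (simp_all add: ad ng c[symmetric] m_assoc zm_def r_inv) (simp add: m_comm)
  qed
  have "ab_category C zm add neg"
  proof unfold_locales
    show "zm A B \<in> Arr C" "Dom C (zm A B) = A" "Cod C (zm A B) = B" if "A \<in> Obj C" "B \<in> Obj C" for A B
      using one[OF that] by (auto simp: Hom_iff)
    show "zm A B \<bullet> f = zm (Dom C f) B" if f: "f \<in> Arr C" "Cod C f = A" "B \<in> Obj C" for f A B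
    proof (rule idem)
      have A: "A \<in> Obj C" using f by auto
      show "zm A B \<bullet> f \<in> Hom C (Dom C f) B"
        using f one[OF A f(3)] by (auto simp: Hom_iff)
      show "(zm A B \<bullet> f) \<otimes>\<^bsub>G (Dom C f) B\<^esub> (zm A B \<bullet> f) = zm A B \<bullet> f"
        using f A one[OF A f(3)] zz[OF A f(3)] distrib[of f "Dom C f" A "zm A B" B "zm A B"]
        by (simp add: Hom_iff)
    qed (use f in auto)
    show "f \<bullet> zm A B = zm A (Cod C f)" if f: "f \<in> Arr C" "Dom C f = B" "A \<in> Obj C" for f A B
    proof (rule idem)
      have B: "B \<in> Obj C" using f by auto
      show "f \<bullet> zm A B \<in> Hom C A (Cod C f)"
        using f one[OF f(3) B] by (auto simp: Hom_iff)
      show "(f \<bullet> zm A B) \<otimes>\<^bsub>G A (Cod C f)\<^esub> (f \<bullet> zm A B) = f \<bullet> zm A B"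
        using f B one[OF f(3) B] zz[OF f(3) B] distrib'[of "zm A B" A B "zm A B" f "Cod C f"]
        by (simp add: Hom_iff)
    qed (use f in auto)
    fix f g
    assume f: "f \<in> Arr C" and g: "g \<in> Arr C" and fg: "Dom C f = Dom C g" "Cod C f = Cod C g"
    show "add f g \<in> Arr C" "Dom C (add f g) = Dom C g" "Cod C (add f g) = Cod C g" "add f g = add g f"
      using f g fg add(1,2)[of f "Dom C g" "Cod C g" g] by (simp_all add: Hom_iff)
    show "add (add f g) h = add f (add g h)" if "h \<in> Arr C" "Dom C g = Dom C h" "Cod C g = Cod C h" for h
      using f g fg that add(6)[of f "Dom C h" "Cod C h" g h] by (simp add: Hom_iff)
    show "add f g \<bullet> h = add (f \<bullet> h) (g \<bullet> h)" if "h \<in> Arr C" "Cod C h = Dom C g" for h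
      using f g fg that distrib[of h "Dom C h" "Dom C g" f "Cod C g" g] by (simp add: Hom_iff add_def)
    show "h \<bullet> add f g = add (h \<bullet> f) (h \<bullet> g)" if "h \<in> Arr C" "Cod C g = Dom C h" for h
      using f g fg that distrib'[of f "Dom C g" "Dom C h" g h "Cod C h"] by (simp add: Hom_iff add_def)
  next
    fix f assume f: "f \<in> Arr C"
    show "add f (zm A B) = f" if "Dom C f = A" "Cod C f = B" for A B
      using f that add(3)[of f A B] by (simp add: Hom_iff)
    show "neg f \<in> Arr C" "Dom C (neg f) = Dom C f" "Cod C (neg f) = Cod C f"
      "add f (neg f) = zm (Dom C f) (Cod C f)"
      using f add(4,5)[of f "Dom C f" "Cod C f"] by (simp_all add: Hom_iff)
  qed
  then show ?thesis by blast
qed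

section \<open>Clauses (b), (c) and (d) in an additive category\<close>

locale ab_coproduct_category = ab_category C zm add neg + cmon_coproduct_category C zm add inl inr
  for C :: "('o, 'm) cat" (structure) and zm and add (infixl "\<boxplus>" 65) and neg inl inr
begin

lemma cmap_square:
  assumes "commutative_square C t l r b" "commutative_square C t' l' r' b'"
  shows "commutative_square C (cmap t t') (cmap l l') (cmap r r') (cmap b b')"
  unfolding commutative_square_def
proof (intro conjI)
  show "cmap r r' \<bullet> cmap t t' = cmap b b' \<bullet> cmap l l'"
    by (rule coprod_eqI[of _ _ "Dom C l" "Dom C l'"]) (use assms in \<open>auto simp: commutative_square_def\<close>)
qed (use assms in \<open>auto simp: commutative_square_def\<close>)

text \<open>Coordinates split a test square for the sum into one test square for each summand; the
  two mediating arrows \<open>u\<close> and \<open>v\<close> reassemble to (u, v).\<close>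

lemma condition_b: "condition_b C inl inr"
  unfolding condition_b_def
proof (intro allI impI, elim conjE)
  fix t l r b t' l' r' b'
  assume pb: "is_pullback C t l r b" and pb': "is_pullback C t' l' r' b'"
  have sq: "commutative_square C t l r b" and sq': "commutative_square C t' l' r' b'"
    using pb pb' by (auto simp: is_pullback_def)
  then have [simp]: "t \<in> Arr C" "l \<in> Arr C" "r \<in> Arr C" "b \<in> Arr C" "Dom C t = Dom C l" "Cod C t = Dom C r"
      "Cod C l = Dom C b" "Cod C r = Cod C b" "t' \<in> Arr C" "l' \<in> Arr C" "r' \<in> Arr C" "b' \<in> Arr C"
      "Dom C t' = Dom C l'" "Cod C t' = Dom C r'" "Cod C l' = Dom C b'" "Cod C r' = Cod C b'"
    by (auto simp: commutative_square_def)
  show "is_pullback C (cmap t t') (cmap l l') (cmap r r') (cmap b b')"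
    unfolding is_pullback_def
  proof (intro conjI allI impI)
    show "commutative_square C (cmap t t') (cmap l l') (cmap r r') (cmap b b')"
      by (rule cmap_square[OF sq sq'])
    fix f g assume fg: "commutative_square C f g (cmap r r') (cmap b b')"
    then have [simp]: "f \<in> Arr C" "g \<in> Arr C" "Dom C f = Dom C g"
        "Cod C f = Cod C (inl (Dom C r) (Dom C r'))" "Cod C g = Cod C (inl (Dom C b) (Dom C b'))"
      and eq: "cmap r r' \<bullet> f = cmap b b' \<bullet> g"
      by (auto simp: commutative_square_def)
    have "r \<bullet> (pr1 (Dom C r) (Dom C r') \<bullet> f) = b \<bullet> (pr1 (Dom C b) (Dom C b') \<bullet> g)"
      using arg_cong[OF eq, of "\<lambda>w. pr1 (Cod C b) (Cod C b') \<bullet> w"] by simp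
    then have "commutative_square C (pr1 (Dom C r) (Dom C r') \<bullet> f) (pr1 (Dom C b) (Dom C b') \<bullet> g) r b"
      by (simp add: commutative_square_def)
    from pullback_ex1[OF pb this]
    have "\<exists>!u. u \<in> Hom C (Dom C g) (Dom C l) \<and> t \<bullet> u = pr1 (Dom C r) (Dom C r') \<bullet> f \<and> l \<bullet> u = pr1 (Dom C b) (Dom C b') \<bullet> g"
      by simp
    then obtain u where u: "u \<in> Hom C (Dom C g) (Dom C l)" "t \<bullet> u = pr1 (Dom C r) (Dom C r') \<bullet> f" "l \<bullet> u = pr1 (Dom C b) (Dom C b') \<bullet> g"
      and u_unique: "\<And>w. w \<in> Hom C (Dom C g) (Dom C l) \<Longrightarrow> t \<bullet> w = pr1 (Dom C r) (Dom C r') \<bullet> f \<Longrightarrow> l \<bullet> w = pr1 (Dom C b) (Dom C b') \<bullet> g \<Longrightarrow> w = u"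
      by metis
    have "r' \<bullet> (pr2 (Dom C r) (Dom C r') \<bullet> f) = b' \<bullet> (pr2 (Dom C b) (Dom C b') \<bullet> g)"
      using arg_cong[OF eq, of "\<lambda>w. pr2 (Cod C b) (Cod C b') \<bullet> w"] by simp
    then have "commutative_square C (pr2 (Dom C r) (Dom C r') \<bullet> f) (pr2 (Dom C b) (Dom C b') \<bullet> g) r' b'"
      by (simp add: commutative_square_def)
    from pullback_ex1[OF pb' this]
    have "\<exists>!u. u \<in> Hom C (Dom C g) (Dom C l') \<and> t' \<bullet> u = pr2 (Dom C r) (Dom C r') \<bullet> f \<and> l' \<bullet> u = pr2 (Dom C b) (Dom C b') \<bullet> g"
      by simp
    then obtain v where v: "v \<in> Hom C (Dom C g) (Dom C l')" "t' \<bullet> v = pr2 (Dom C r) (Dom C r') \<bullet> f" "l' \<bullet> v = pr2 (Dom C b) (Dom C b') \<bullet> g"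
      and v_unique: "\<And>w. w \<in> Hom C (Dom C g) (Dom C l') \<Longrightarrow> t' \<bullet> w = pr2 (Dom C r) (Dom C r') \<bullet> f \<Longrightarrow> l' \<bullet> w = pr2 (Dom C b) (Dom C b') \<bullet> g \<Longrightarrow> w = v"
      by metis
    have [simp]: "u \<in> Arr C" "Dom C u = Dom C g" "Cod C u = Dom C l" "v \<in> Arr C" "Dom C v = Dom C g" "Cod C v = Dom C l'"
      using u v by (auto simp: Hom_iff)
    let ?w = "inl (Dom C l) (Dom C l') \<bullet> u \<boxplus> inr (Dom C l) (Dom C l') \<bullet> v"
    show "\<exists>!w. w \<in> Hom C (Dom C f) (Dom C (cmap t t')) \<and> cmap t t' \<bullet> w = f \<and> cmap l l' \<bullet> w = g"
    proof (rule ex1I[of _ ?w])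
      have "cmap t t' \<bullet> ?w = f"
        by (rule biprod_eqI[of _ _ "Dom C r" "Dom C r'"]) (simp_all add: u v)
      moreover have "cmap l l' \<bullet> ?w = g"
        by (rule biprod_eqI[of _ _ "Dom C b" "Dom C b'"]) (simp_all add: u v)
      ultimately show "?w \<in> Hom C (Dom C f) (Dom C (cmap t t')) \<and> cmap t t' \<bullet> ?w = f \<and> cmap l l' \<bullet> ?w = g"
        by (auto simp: Hom_iff)
      fix w assume w: "w \<in> Hom C (Dom C f) (Dom C (cmap t t')) \<and> cmap t t' \<bullet> w = f \<and> cmap l l' \<bullet> w = g"
      then have [simp]: "w \<in> Arr C" "Dom C w = Dom C g" "Cod C w = Cod C (inl (Dom C l) (Dom C l'))"
        by (auto simp: Hom_iff)
      have wf: "f = cmap t t' \<bullet> w" and wg: "g = cmap l l' \<bullet> w" using w by auto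
      have "pr1 (Dom C l) (Dom C l') \<bullet> w = u"
        by (rule u_unique) (simp_all add: Hom_iff, simp_all add: wf wg)
      moreover have "pr2 (Dom C l) (Dom C l') \<bullet> w = v"
        by (rule v_unique) (simp_all add: Hom_iff, simp_all add: wf wg)
      ultimately show "w = ?w"
        by (intro biprod_eqI[of w ?w "Dom C l" "Dom C l'"]) simp_all
    qed
  qed
qed

text \<open>Test data are (a, s) and t with a + ms = mt. Then a = m(t - s), so the mediating element
  of \<open>S + S\<close> is (t - s, s).\<close>

lemma condition_c: "condition_c C inl inr"
  unfolding condition_c_def
proof (intro allI impI, elim conjE)
  fix S A m assume m: "m \<in> Hom C S A"
  then have m' [simp]: "m \<in> Arr C" "Dom C m = S" "Cod C m = A"
    by (auto simp: Hom_iff)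
  have [simp]: "S \<in> Obj C" "A \<in> Obj C"
    using Dom_in_Obj[OF m'(1)] Cod_in_Obj[OF m'(1)] by simp_all
  show "is_pullback C (cmap m (Id C S)) (cp (Id C S) (Id C S)) (cp (Id C A) m) m"
    unfolding is_pullback_def
  proof (intro conjI allI impI)
    have "cp (Id C A) m \<bullet> cmap m (Id C S) = m \<bullet> cp (Id C S) (Id C S)"
      by (rule coprod_eqI[of _ _ S S]) simp_all
    then show "commutative_square C (cmap m (Id C S)) (cp (Id C S) (Id C S)) (cp (Id C A) m) m"
      by (simp add: commutative_square_def)
    fix f g assume fg: "commutative_square C f g (cp (Id C A) m) m"
    then have [simp]: "f \<in> Arr C" "g \<in> Arr C" "Dom C f = Dom C g" "Cod C f = Cod C (inl A S)" "Cod C g = S"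
      and "cp (Id C A) m \<bullet> f = m \<bullet> g"
      by (auto simp: commutative_square_def)
    then have eq: "m \<bullet> g = pr1 A S \<bullet> f \<boxplus> m \<bullet> (pr2 A S \<bullet> f)"
      by (simp add: copair_comp)
    let ?x = "g \<boxplus> neg (pr2 A S \<bullet> f)"
    let ?w = "inl S S \<bullet> ?x \<boxplus> inr S S \<bullet> (pr2 A S \<bullet> f)"
    show "\<exists>!w. w \<in> Hom C (Dom C f) (Dom C (cmap m (Id C S))) \<and> cmap m (Id C S) \<bullet> w = f \<and> cp (Id C S) (Id C S) \<bullet> w = g"
    proof (rule ex1I[of _ ?w])
      have mx: "m \<bullet> ?x = pr1 A S \<bullet> f"
        by (simp add: eq)
      have "cmap m (Id C S) \<bullet> ?w = f"
        by (rule biprod_eqI[of _ _ A S]) (use mx in simp_all)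
      moreover have "cp (Id C S) (Id C S) \<bullet> ?w = g"
        by (simp add: codiag_comp)
      ultimately show "?w \<in> Hom C (Dom C f) (Dom C (cmap m (Id C S))) \<and> cmap m (Id C S) \<bullet> ?w = f \<and> cp (Id C S) (Id C S) \<bullet> ?w = g"
        by (auto simp: Hom_iff)
      fix w assume w: "w \<in> Hom C (Dom C f) (Dom C (cmap m (Id C S))) \<and> cmap m (Id C S) \<bullet> w = f \<and> cp (Id C S) (Id C S) \<bullet> w = g"
      then have [simp]: "w \<in> Arr C" "Dom C w = Dom C g" "Cod C w = Cod C (inl S S)"
        by (auto simp: Hom_iff)
      have "f = cmap m (Id C S) \<bullet> w"
        using w by simp
      then have p2: "pr2 A S \<bullet> f = pr2 S S \<bullet> w"
        by (rule ssubst) simp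
      have g: "pr1 S S \<bullet> w \<boxplus> pr2 S S \<bullet> w = g"
        using w codiag_comp[of S w] by simp
      have "pr1 S S \<bullet> w = ?x"
        unfolding p2 g[symmetric] by simp
      then show "w = ?w"
        by (intro biprod_eqI[of w ?w S S]) (simp_all add: p2)
    qed
  qed
qed

text \<open>The equation b + b' = pe defining the pullback can be solved for b', so b and e are free
  parameters.\<close>

lemma codiag_pullback:
  assumes p: "p \<in> Hom C E B"
  shows "is_pullback C (inl B B \<bullet> pr1 B E \<boxplus> inr B B \<bullet> (p \<bullet> pr2 B E \<boxplus> neg (pr1 B E))) (pr2 B E) (cp (Id C B) (Id C B)) p"
    (is "is_pullback C ?t _ _ _")
proof -
  have p' [simp]: "p \<in> Arr C" "Dom C p = E" "Cod C p = B"
    using p by (auto simp: Hom_iff)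
  have [simp]: "E \<in> Obj C" "B \<in> Obj C"
    using Dom_in_Obj[OF p'(1)] Cod_in_Obj[OF p'(1)] by simp_all
  show ?thesis
    unfolding is_pullback_def
  proof (intro conjI allI impI)
    show "commutative_square C ?t (pr2 B E) (cp (Id C B) (Id C B)) p"
      by (simp add: commutative_square_def codiag_comp)
    fix f g assume fg: "commutative_square C f g (cp (Id C B) (Id C B)) p"
    then have [simp]: "f \<in> Arr C" "g \<in> Arr C" "Dom C f = Dom C g" "Cod C f = Cod C (inl B B)" "Cod C g = E"
      and "cp (Id C B) (Id C B) \<bullet> f = p \<bullet> g"
      by (auto simp: commutative_square_def)
    then have eq: "p \<bullet> g = pr1 B B \<bullet> f \<boxplus> pr2 B B \<bullet> f"
      by (simp add: codiag_comp)
    let ?w = "inl B E \<bullet> (pr1 B B \<bullet> f) \<boxplus> inr B E \<bullet> g"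
    show "\<exists>!w. w \<in> Hom C (Dom C f) (Dom C ?t) \<and> ?t \<bullet> w = f \<and> pr2 B E \<bullet> w = g"
    proof (rule ex1I[of _ ?w])
      have "?t \<bullet> ?w = f"
        by (rule biprod_eqI[of _ _ B B]) (simp_all add: eq)
      then show "?w \<in> Hom C (Dom C f) (Dom C ?t) \<and> ?t \<bullet> ?w = f \<and> pr2 B E \<bullet> ?w = g"
        by (auto simp: Hom_iff)
      fix w assume w: "w \<in> Hom C (Dom C f) (Dom C ?t) \<and> ?t \<bullet> w = f \<and> pr2 B E \<bullet> w = g"
      then have [simp]: "w \<in> Arr C" "Dom C w = Dom C g" "Cod C w = Cod C (inl B E)"
        by (auto simp: Hom_iff)
      have "f = ?t \<bullet> w"
        using w by (elim conjE) (rule sym)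
      then have "pr1 B B \<bullet> f = pr1 B E \<bullet> w"
        by (rule ssubst) simp
      then show "w = ?w"
        using w by (intro biprod_eqI[of w ?w B E]) (simp_all del: add_comp)
    qed
  qed
qed

text \<open>In terms of generalized elements the comparison map is \<open>(x, y) \<mapsto> (p x, x + y)\<close>. The shear
  \<open>(x, y) \<mapsto> (x, x + y)\<close> turns it into \<open>p \<oplus> 1\<close>, and \<open>\<sigma> = (1, -1)\<close> is the shear's inverse applied
  to \<open>(x, 0)\<close>.\<close>

lemma regular_epi_comparison:
  assumes p: "p \<in> Hom C E B" and reg: "is_regular_epi C p"
  shows "is_regular_epi C (inl B E \<bullet> (p \<bullet> pr1 E E) \<boxplus> inr B E \<bullet> (pr1 E E \<boxplus> pr2 E E))" (is "is_regular_epi C ?w")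
proof -
  have p' [simp]: "p \<in> Arr C" "Dom C p = E" "Cod C p = B"
    using p by (auto simp: Hom_iff)
  have [simp]: "E \<in> Obj C" "B \<in> Obj C"
    using Dom_in_Obj[OF p'(1)] Cod_in_Obj[OF p'(1)] by simp_all
  obtain f g where co: "is_coequalizer C f g p"
    using reg by (auto simp: is_regular_epi_def)
  then have [simp]: "f \<in> Arr C" "Cod C f = E" "g \<in> Arr C" "Cod C g = E" "Dom C g = Dom C f"
    and eq: "p \<bullet> f = p \<bullet> g"
    by (auto simp: is_coequalizer_def Hom_iff)
  have desc: "\<exists>!u. u \<in> Hom C B X \<and> u \<bullet> p = h" if "h \<in> Hom C E X" "h \<bullet> f = h \<bullet> g" for h X
    using co that by (simp add: is_coequalizer_def)
  define \<sigma> where "\<sigma> = inl E E \<boxplus> inr E E \<bullet> neg (Id C E)"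
  have [simp]: "\<sigma> \<in> Arr C" "Dom C \<sigma> = E" "Cod C \<sigma> = Cod C (inl E E)"
    by (simp_all add: \<sigma>_def)
  have w\<sigma>: "?w \<bullet> \<sigma> = inl B E \<bullet> p"
    by (rule biprod_eqI[of _ _ B E]) (simp_all add: \<sigma>_def)
  have w_inr: "?w \<bullet> inr E E = inr B E"
    by (rule biprod_eqI[of _ _ B E]) simp_all
  \<comment> \<open>If \<open>p\<close> coequalizes \<open>f\<close> and \<open>g\<close>, then p
    \<oplus> 1 coequalizes (f, 0) and (g, 0); \<sigma> transports this pair along the inverse
    shear.\<close>
  have "is_coequalizer C (\<sigma> \<bullet> f) (\<sigma> \<bullet> g) ?w"
    unfolding is_coequalizer_def
  proof (intro conjI allI ballI impI)
    show "?w \<bullet> (\<sigma> \<bullet> f) = ?w \<bullet> (\<sigma> \<bullet> g)"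
      using Comp_eq_assoc[OF w\<sigma>, of f] Comp_eq_assoc[OF w\<sigma>, of g] by (simp del: add_comp add: eq)
    fix X h assume h: "h \<in> Hom C (Dom C ?w) X" and hfg: "h \<bullet> (\<sigma> \<bullet> f) = h \<bullet> (\<sigma> \<bullet> g)"
    then have [simp]: "h \<in> Arr C" "Dom C h = Cod C (inl E E)" "Cod C h = X"
      by (auto simp: Hom_iff)
    have "\<exists>!u. u \<in> Hom C B X \<and> u \<bullet> p = h \<bullet> \<sigma>"
      by (rule desc) (use hfg in \<open>simp_all add: Hom_iff\<close>)
    then obtain v where v: "v \<in> Hom C B X" "v \<bullet> p = h \<bullet> \<sigma>"
      and v_unique: "\<And>u. u \<in> Hom C B X \<Longrightarrow> u \<bullet> p = h \<bullet> \<sigma> \<Longrightarrow> u = v"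
      by metis
    have [simp]: "v \<in> Arr C" "Dom C v = B" "Cod C v = X"
      using v(1) by (simp_all add: Hom_iff)
    have vp: "v \<bullet> (p \<bullet> x) = h \<bullet> (\<sigma> \<bullet> x)" if "x \<in> Arr C" "Cod C x = E" for x
      using Comp_eq_assoc[OF v(2), of x] that by simp
    show "\<exists>!u. u \<in> Hom C (Cod C ?w) X \<and> u \<bullet> ?w = h"
    \<comment> \<open>On \<open>B\<close> the factorization must be the descent \<open>v\<close> of
      \<open>h \<bullet> \<sigma>\<close> along \<open>p\<close>, by \<open>w\<sigma>\<close>; on
      \<open>E\<close> it is forced by \<open>w_inr\<close>.\<close>
    proof (rule ex1I[of _ "cp v (h \<bullet> inr E E)"])
      have "cp v (h \<bullet> inr E E) \<bullet> ?w = h \<bullet> (\<sigma> \<bullet> pr1 E E \<boxplus> inr E E \<bullet> (pr1 E E \<boxplus> pr2 E E))"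
        by (simp add: vp)
      \<comment> \<open>In elements: (x, -x) + (0, x + y) = (x, y).\<close>
      also have "\<sigma> \<bullet> pr1 E E \<boxplus> inr E E \<bullet> (pr1 E E \<boxplus> pr2 E E) = Id C (Cod C (inl E E))"
        by (rule biprod_eqI[of _ _ E E]) (simp_all add: \<sigma>_def add_assoc[symmetric])
      finally show "cp v (h \<bullet> inr E E) \<in> Hom C (Cod C ?w) X \<and> cp v (h \<bullet> inr E E) \<bullet> ?w = h"
        by (simp add: Hom_iff)
      fix u assume "u \<in> Hom C (Cod C ?w) X \<and> u \<bullet> ?w = h"
      then have [simp]: "u \<in> Arr C" "Dom C u = Cod C (inl B E)" "Cod C u = X" and u: "u \<bullet> ?w = h"
        by (auto simp: Hom_iff)
      have "u \<bullet> (?w \<bullet> \<sigma>) = h \<bullet> \<sigma>" "u \<bullet> (?w \<bullet> inr E E) = h \<bullet> inr E E"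
        by (rule Comp_eq_assoc[OF u]; simp)+
      then have "(u \<bullet> inl B E) \<bullet> p = h \<bullet> \<sigma>" "u \<bullet> inr B E = h \<bullet> inr E E"
        unfolding w\<sigma> w_inr by simp_all
      moreover from this(1) have "u \<bullet> inl B E = v"
        by (intro v_unique) (simp_all add: Hom_iff)
      ultimately show "u = cp v (h \<bullet> inr E E)"
        by (intro coprod_eqI[of u _ B E]) simp_all
    qed
  qed (simp_all add: Hom_iff)
  then show ?thesis
    unfolding is_regular_epi_def by blast
qed

lemma condition_d: "condition_d C inl inr"
  unfolding condition_d_def
proof (intro allI impI, elim conjE)
  fix E B p assume p: "p \<in> Hom C E B" and reg: "is_regular_epi C p"
  have p' [simp]: "p \<in> Arr C" "Dom C p = E" "Cod C p = B"
    using p by (auto simp: Hom_iff)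
  have [simp]: "E \<in> Obj C" "B \<in> Obj C"
    using Dom_in_Obj[OF p'(1)] Cod_in_Obj[OF p'(1)] by simp_all
  let ?t = "inl B B \<bullet> pr1 B E \<boxplus> inr B B \<bullet> (p \<bullet> pr2 B E \<boxplus> neg (pr1 B E))"
  let ?w = "inl B E \<bullet> (p \<bullet> pr1 E E) \<boxplus> inr B E \<bullet> (pr1 E E \<boxplus> pr2 E E)"
  \<comment> \<open>In elements: (x, y) goes to (px, x + y) and then to (px, p(x + y) - px) = (px,
    py).\<close>
  have "?t \<bullet> ?w = cmap p p"
    by (rule biprod_eqI[of _ _ B B]) simp_all
  moreover have codiag: "cp (Id C E) (Id C E) = pr1 E E \<boxplus> pr2 E E"
    using codiag_comp[of E "Id C (Cod C (inl E E))"] by simp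
  then have "pr2 B E \<bullet> ?w = cp (Id C E) (Id C E)"
    by simp
  moreover have "commutative_square C (cmap p p) (cp (Id C E) (Id C E)) (cp (Id C B) (Id C B)) p"
    by (simp add: commutative_square_def codiag_comp) (simp add: codiag)
  moreover have "?w \<in> Hom C (Dom C (cmap p p)) (Dom C ?t)"
    by (simp add: Hom_iff)
  ultimately show "is_feeble_pullback C (cmap p p) (cp (Id C E) (Id C E)) (cp (Id C B) (Id C B)) p"
    unfolding is_feeble_pullback_def
    using codiag_pullback[OF p] regular_epi_comparison[OF p reg] by blast
qed

end

lemma (in category) condition_P_if_additive:
  assumes "is_additive C"
  shows "condition_P C"
proof -
  obtain zm add neg where "ab_category C zm add neg"
    using ab_category_if_additive assms by blast
  then interpret ab_category C zm add neg .
  obtain Z where Z: "is_zero_object C Z"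
    using assms by (auto simp: is_additive_def is_pointed_def)
  have "has_finite_coproducts C"
  proof (rule finite_coproducts_of_binary)
    show "Z \<in> Obj C"
      using Z by (simp add: is_zero_object_def)
    show "\<exists>!f. f \<in> Hom C Z A" if "A \<in> Obj C" for A
      using Z that by (simp add: is_zero_object_def)
    show "\<exists>K i j. is_coproduct C A B K i j" if "A \<in> Obj C" "B \<in> Obj C" for A B
      using assms coproduct_of_product that unfolding is_additive_def has_binary_products_def by meson
  qed
  moreover have "condition_b C inl inr \<and> condition_c C inl inr \<and> condition_d C inl inr"
    if "coproduct_choice C inl inr" for inl inr
  proof -
    interpret coproduct_category C inl inr
      by unfold_locales (rule that)
    interpret ab_coproduct_category C zm add neg inl inr ..
    show ?thesis
      using condition_b condition_c condition_d by blast
  qed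
  ultimately show ?thesis
    by (auto simp: condition_P_def)
qed

theorem proposition3p4:
  fixes C :: "('o, 'm) cat"
  assumes "category C" and "is_pointed C" and "has_finite_limits C"
  shows "is_additive C \<longleftrightarrow> condition_P C"
proof -
  interpret category C by (rule assms(1))
  show ?thesis
    using additive_if_condition_P[OF assms(2)] condition_P_if_additive by blast
qed

end
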